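(* Let $G$ be a finite group and suppose $\mathrm{cs}(G)=\{a_0,a_0+d,\dots,a_0+rd\}$, where $a_0,d,r$ are integers with $a_0,d\ge 1$ and $r\ge 2$. Then $a_0=d=1$ and $r=2$, so $\mathrm{cs}(G)=\{1,2,3\}$, and $G\cong G_n\times C$ for some $n\ge 1$, where $$G_n=\langle a,b\mid a^{2^n}=b^3=1,\; b^a=b^{-1}\rangle$$ and $C$ is a finite abelian group; moreover (identifying $G$ with $G_n\times C$) $G/\mathrm{Z}(G)\cong \mathrm{S}_3$ where $\mathrm{Z}(G)=\langle a^2\rangle\times C$. Conversely, $\mathrm{cs}(G_n\times C)=\{1,2,3\}$ for all $n\ge 1$ and all finite abelian groups $C$.
   Context: For a finite group $G$, $\mathrm{cs}(G)$ denotes the set of sizes of conjugacy classes of $G$. $b^a=a^{-1}ba$, $\mathrm{Z}(G)$ is the center of $G$, and $\mathrm{S}_3$ is the symmetric group of degree 3. *)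

theory Defs
  imports "HOL-Algebra.Algebra"
begin

definition conj_classes :: "('a, 'm) monoid_scheme \<Rightarrow> 'a set set" where
  "conj_classes G =
     orbits G (carrier G) (\<lambda>g. \<lambda>h \<in> carrier G. g \<otimes>\<^bsub>G\<^esub> h \<otimes>\<^bsub>G\<^esub> inv\<^bsub>G\<^esub> g)"

definition cs :: "('a, 'm) monoid_scheme \<Rightarrow> nat set" where
  "cs G = card ` conj_classes G"

definition center :: "('a, 'm) monoid_scheme \<Rightarrow> 'a set" where
  "center G = {z \<in> carrier G. \<forall>g \<in> carrier G. z \<otimes>\<^bsub>G\<^esub> g = g \<otimes>\<^bsub>G\<^esub> z}"


text \<open>
  Groups given by generators and relations. The generators are the elements of the type
  \<open>'g\<close>; a letter \<open>(x, True)\<close> stands for \<open>x\<close> and \<open>(x, False)\<close> for its formal inverse. A pair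
  \<open>(u, v) \<in> R\<close> is the defining relation \<open>u = v\<close>. The group consists of the classes of words
  modulo the least congruence that contains free cancellation and \<open>R\<close>.
\<close>

type_synonym 'g word = "('g \<times> bool) list"

inductive word_eq :: "('g word \<times> 'g word) set \<Rightarrow> 'g word \<Rightarrow> 'g word \<Rightarrow> bool"
  for R :: "('g word \<times> 'g word) set"
  where
    refl: "word_eq R u u"
  | sym: "word_eq R u v \<Longrightarrow> word_eq R v u"
  | trans: "word_eq R u v \<Longrightarrow> word_eq R v w \<Longrightarrow> word_eq R u w"
  | append: "word_eq R u u' \<Longrightarrow> word_eq R v v' \<Longrightarrow> word_eq R (u @ v) (u' @ v')"
  | cancel: "word_eq R [(x, s), (x, \<not> s)] []"
  | relation: "(u, v) \<in> R \<Longrightarrow> word_eq R u v"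

definition word_class :: "('g word \<times> 'g word) set \<Rightarrow> 'g word \<Rightarrow> 'g word set" where
  "word_class R u = {v. word_eq R u v}"

definition presented_group :: "('g word \<times> 'g word) set \<Rightarrow> 'g word set monoid" where
  "presented_group R =
     \<lparr>carrier = range (word_class R),
      monoid.mult = (\<lambda>U V. \<Union>u\<in>U. \<Union>v\<in>V. word_class R (u @ v)),
      one = word_class R []\<rparr>"

abbreviation gen_elt :: "('g word \<times> 'g word) set \<Rightarrow> 'g \<Rightarrow> 'g word set" where
  "gen_elt R x \<equiv> word_class R [(x, True)]"

lemma word_class_eq_iff: "word_class R u = word_class R v \<longleftrightarrow> word_eq R u v"
proof
  assume "word_class R u = word_class R v"
  then have "v \<in> word_class R u" by (simp add: word_class_def word_eq.refl)
  then show "word_eq R u v" by (simp add: word_class_def)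
next
  assume uv: "word_eq R u v"
  show "word_class R u = word_class R v"
    unfolding word_class_def
    using word_eq.trans[OF uv] word_eq.trans[OF word_eq.sym[OF uv]] by blast
qed

lemma carrier_presented_group: "carrier (presented_group R) = range (word_class R)"
  by (simp add: presented_group_def)

lemma one_presented_group: "\<one>\<^bsub>presented_group R\<^esub> = word_class R []"
  by (simp add: presented_group_def)

lemma mult_presented_group:
  "word_class R u \<otimes>\<^bsub>presented_group R\<^esub> word_class R v = word_class R (u @ v)"
proof -
  have "word_class R (u' @ v') = word_class R (u @ v)"
    if "u' \<in> word_class R u" "v' \<in> word_class R v" for u' v'
  proof -
    have "word_eq R u u'" "word_eq R v v'"
      using that by (simp_all add: word_class_def)
    then show ?thesis
      unfolding word_class_eq_iff by (intro word_eq.append) (rule word_eq.sym, assumption)+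
  qed
  moreover have "u \<in> word_class R u" "v \<in> word_class R v"
    by (simp_all add: word_class_def word_eq.refl)
  ultimately have
    "(\<Union>u'\<in>word_class R u. \<Union>v'\<in>word_class R v. word_class R (u' @ v')) = word_class R (u @ v)"
    by blast
  then show ?thesis by (simp add: presented_group_def)
qed

lemma word_eq_inverse: "\<exists>v. word_eq R (v @ u) []"
proof (induction u)
  case Nil
  show ?case by (rule exI[of _ "[]"]) (simp add: word_eq.refl)
next
  case (Cons l u)
  obtain x s where l: "l = (x, s)" by (cases l)
  from Cons obtain v where v: "word_eq R (v @ u) []" by blast
  have "word_eq R [(x, \<not> s), (x, s)] []"
    using word_eq.cancel[of R x "\<not> s"] by simp
  then have "word_eq R ([(x, \<not> s), (x, s)] @ u) ([] @ u)"
    by (intro word_eq.append word_eq.refl)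
  then have "word_eq R (v @ [(x, \<not> s), (x, s)] @ u) (v @ u)"
    by (intro word_eq.append word_eq.refl) simp
  then have "word_eq R (v @ [(x, \<not> s), (x, s)] @ u) []"
    using v by (rule word_eq.trans)
  then have "word_eq R ((v @ [(x, \<not> s)]) @ l # u) []"
    by (simp add: l)
  then show ?case by blast
qed

lemma word_class_in_carrier: "word_class R u \<in> carrier (presented_group R)"
  by (simp add: carrier_presented_group)

lemma presented_group_cases:
  assumes "U \<in> carrier (presented_group R)"
  obtains u where "U = word_class R u"
  using assms unfolding carrier_presented_group by (rule rangeE)

lemma group_presented_group: "group (presented_group R)"
proof (rule groupI)
  show "\<one>\<^bsub>presented_group R\<^esub> \<in> carrier (presented_group R)"
    by (simp add: one_presented_group word_class_in_carrier)
next
  fix U V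
  assume "U \<in> carrier (presented_group R)" "V \<in> carrier (presented_group R)"
  then show "U \<otimes>\<^bsub>presented_group R\<^esub> V \<in> carrier (presented_group R)"
    by (elim presented_group_cases) (simp add: mult_presented_group word_class_in_carrier)
next
  fix U V W
  assume "U \<in> carrier (presented_group R)" "V \<in> carrier (presented_group R)"
    "W \<in> carrier (presented_group R)"
  then show "U \<otimes>\<^bsub>presented_group R\<^esub> V \<otimes>\<^bsub>presented_group R\<^esub> W =
      U \<otimes>\<^bsub>presented_group R\<^esub> (V \<otimes>\<^bsub>presented_group R\<^esub> W)"
    by (elim presented_group_cases) (simp add: mult_presented_group)
next
  fix U assume "U \<in> carrier (presented_group R)"
  then show "\<one>\<^bsub>presented_group R\<^esub> \<otimes>\<^bsub>presented_group R\<^esub> U = U"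
    by (elim presented_group_cases) (simp add: mult_presented_group one_presented_group)
next
  fix U assume "U \<in> carrier (presented_group R)"
  then obtain u where u: "U = word_class R u" by (rule presented_group_cases)
  obtain v where "word_eq R (v @ u) []" using word_eq_inverse by blast
  then have "word_class R v \<otimes>\<^bsub>presented_group R\<^esub> U = \<one>\<^bsub>presented_group R\<^esub>"
    by (simp add: u mult_presented_group one_presented_group word_class_eq_iff)
  then show "\<exists>V \<in> carrier (presented_group R). V \<otimes>\<^bsub>presented_group R\<^esub> U = \<one>\<^bsub>presented_group R\<^esub>"
    using word_class_in_carrier by blast
qed

fun eval_word :: "('a, 'm) monoid_scheme \<Rightarrow> ('g \<Rightarrow> 'a) \<Rightarrow> 'g word \<Rightarrow> 'a" where
  "eval_word K f [] = \<one>\<^bsub>K\<^esub>"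
| "eval_word K f ((x, s) # w) = (if s then f x else inv\<^bsub>K\<^esub> f x) \<otimes>\<^bsub>K\<^esub> eval_word K f w"

lemma (in group) eval_word_closed:
  assumes "range f \<subseteq> carrier G"
  shows "eval_word G f w \<in> carrier G"
proof (induction w)
  case (Cons l w)
  have "f (fst l) \<in> carrier G" using assms by auto
  with Cons show ?case by (cases l) auto
qed simp

lemma (in group) eval_word_append:
  assumes "range f \<subseteq> carrier G"
  shows "eval_word G f (u @ v) = eval_word G f u \<otimes> eval_word G f v"
  using assms
proof (induction u)
  case Nil
  then show ?case by (simp add: eval_word_closed)
next
  case (Cons l u)
  then have "f (fst l) \<in> carrier G" by auto
  with Cons show ?case
    by (cases l) (auto simp: m_assoc eval_word_closed)
qed

lemma (in group) eval_word_word_eq: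
  assumes f: "range f \<subseteq> carrier G"
    and R: "\<And>u v. (u, v) \<in> R \<Longrightarrow> eval_word G f u = eval_word G f v"
    and "word_eq R u v"
  shows "eval_word G f u = eval_word G f v"
  using assms(3)
proof (induction rule: word_eq.induct)
  case (cancel x s)
  have "f x \<in> carrier G" using f by auto
  then show ?case by auto
next
  case (relation u v)
  then show ?case by (rule R)
qed (simp_all add: eval_word_append[OF f])

theorem (in group) presented_group_universal:
  assumes f: "range f \<subseteq> carrier G"
    and R: "\<And>u v. (u, v) \<in> R \<Longrightarrow> eval_word G f u = eval_word G f v"
  shows "\<exists>h \<in> hom (presented_group R) G. \<forall>x. h (gen_elt R x) = f x"
proof -
  define h where "h U = eval_word G f (SOME u. U = word_class R u)" for U
  have h: "h (word_class R u) = eval_word G f u" for u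
  proof -
    have "word_class R u = word_class R (SOME v. word_class R u = word_class R v)"
      by (rule someI[of _ u]) (rule HOL.refl)
    then have "word_eq R u (SOME v. word_class R u = word_class R v)"
      by (simp only: word_class_eq_iff[symmetric])
    from eval_word_word_eq[OF f R this] show ?thesis by (simp add: h_def)
  qed
  have "h \<in> hom (presented_group R) G"
  proof (rule homI)
    fix U assume "U \<in> carrier (presented_group R)"
    then show "h U \<in> carrier G"
      by (elim presented_group_cases) (simp add: h eval_word_closed[OF f])
  next
    fix U V
    assume "U \<in> carrier (presented_group R)" "V \<in> carrier (presented_group R)"
    then show "h (U \<otimes>\<^bsub>presented_group R\<^esub> V) = h U \<otimes> h V"
      by (elim presented_group_cases)
        (simp add: mult_presented_group h eval_word_append[OF f])
  qed
  moreover have "h (gen_elt R x) = f x" for x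
  proof -
    have "f x \<in> carrier G" using f by auto
    then show ?thesis by (simp add: h)
  qed
  ultimately show ?thesis by blast
qed


datatype ab = Gen_a | Gen_b

definition Gn_rels :: "nat \<Rightarrow> (ab word \<times> ab word) set" where
  "Gn_rels n =
     {(replicate (2 ^ n) (Gen_a, True), []),
      (replicate 3 (Gen_b, True), []),
      ([(Gen_a, False), (Gen_b, True), (Gen_a, True)], [(Gen_b, False)])}"

definition Gn :: "nat \<Rightarrow> ab word set monoid" where
  "Gn n = presented_group (Gn_rels n)"

definition Gn_a :: "nat \<Rightarrow> ab word set" where
  "Gn_a n = gen_elt (Gn_rels n) Gen_a"

end

theory Submission
  imports Defs
begin

text \<open>
  If \<open>x\<close>, \<open>y\<close> have coprime class sizes, then the product of their classes is the class of \<open>x \<otimes> y\<close>.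
  Hence, when the class of \<open>x\<close> is largest, its right stabilizer \<open>S\<close> (a normal subgroup whose order
  divides the class size) contains all quotients of conjugates of \<open>y\<close>. For the two largest sizes
  \<open>1 + r * d\<close> and \<open>1 + (r - 1) * d\<close> this forces \<open>card S = 1 + r * d\<close>, and the \<open>d\<close> elements of the coset
  of \<open>y\<close> outside its class must be central. Translating by one of them shows that \<open>S\<close> has exactly \<open>d\<close>
  central elements, so \<open>d\<close> divides \<open>1 + r * d\<close> and \<open>d = 1\<close>; now \<open>S\<close> consists of \<open>\<one>\<close> and a single class.
  If \<open>r \<ge> 3\<close>, an element of class size \<open>r - 1\<close> would produce a class of size \<open>(r - 1) * r > r + 1\<close>.
  For sizes \<open>1\<close>, \<open>2\<close>, \<open>3\<close> the subgroup \<open>S\<close> has order three, every element of class size three inverts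
  \<open>S\<close>, all other elements lie in \<open>S Z(G)\<close>, and the abelian subgroup generated by \<open>Z(G)\<close> and an inverting
  element \<open>x\<close> splits as \<open>\<langle>a\<rangle> \<times> C\<close> with \<open>a\<close> inverting of \<open>2\<close>-power order and \<open>C\<close> central.
\<close>

section \<open>Conjugacy classes and coprime class sizes\<close>

text \<open>All sizes are 1 modulo \<open>d\<close> because the identity has class size 1, so
  neighbouring sizes are coprime. The bound r >= 2 makes the second largest size m exceed d, hence
  exceed half of the largest size M, and a divisor of M that is at least m can only be M. No size
  lies strictly between 1 and 1 + d, so an invariant set of d elements is central. The least direct
  step is that elements u of class size three invert S. If u centralized \<open>k\<close>,
  coprimality would give g commuting with \<open>k\<close> with g u = u g k. An element inverting
  \<open>k\<close> multiplies g and u only by factors from S that commute with both, so it preserves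
  this relation and yet replaces \<open>k\<close> by its inverse. The group G_n is known only
  through generators and relations; not even b != 1 is evident. Elements are brought into the form
  a^i c with c in {1, b, b^-1}, and whether such an expression is trivial is decided in the image of
  a homomorphism: in S_3 for b != 1, in G for injectivity.\<close>

definition (in group) conj :: "'a \<Rightarrow> 'a \<Rightarrow> 'a" where
  "conj g x = g \<otimes> x \<otimes> inv g"

definition (in group) cls :: "'a \<Rightarrow> 'a set" where
  "cls x = (\<lambda>g. conj g x) ` carrier G"

text \<open>Inclusion is enough: right translation is injective, so it permutes a finite set that it
  maps into itself.\<close>

definition (in group) rstab :: "'a set \<Rightarrow> 'a set" where
  "rstab A = {s \<in> carrier G. \<forall>u\<in>A. u \<otimes> s \<in> A}"

context group
begin

lemma inv_cancel_left:
  assumes "x \<in> carrier G" "y \<in> carrier G"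
  shows "inv x \<otimes> (x \<otimes> y) = y" "x \<otimes> (inv x \<otimes> y) = y"
  using assms by (simp_all flip: m_assoc)

lemmas word_simps = m_assoc inv_mult_group inv_cancel_left

lemma conj_closed [simp]: "g \<in> carrier G \<Longrightarrow> x \<in> carrier G \<Longrightarrow> conj g x \<in> carrier G"
  by (simp add: conj_def)

lemma conj_mult:
  "g \<in> carrier G \<Longrightarrow> x \<in> carrier G \<Longrightarrow> y \<in> carrier G \<Longrightarrow> conj g (x \<otimes> y) = conj g x \<otimes> conj g y"
  by (simp add: conj_def word_simps)

lemma conj_conj:
  "g \<in> carrier G \<Longrightarrow> h \<in> carrier G \<Longrightarrow> x \<in> carrier G \<Longrightarrow> conj g (conj h x) = conj (g \<otimes> h) x"
  by (simp add: conj_def word_simps)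

lemma conj_inv: "g \<in> carrier G \<Longrightarrow> x \<in> carrier G \<Longrightarrow> conj g (inv x) = inv (conj g x)"
  by (simp add: conj_def word_simps)

lemma conj_one [simp]: "x \<in> carrier G \<Longrightarrow> conj \<one> x = x"
  by (simp add: conj_def)

lemma conj_one_right [simp]: "g \<in> carrier G \<Longrightarrow> conj g \<one> = \<one>"
  by (simp add: conj_def)

lemma conj_inv_conj [simp]:
  "g \<in> carrier G \<Longrightarrow> x \<in> carrier G \<Longrightarrow> conj (inv g) (conj g x) = x"
  "g \<in> carrier G \<Longrightarrow> x \<in> carrier G \<Longrightarrow> conj g (conj (inv g) x) = x"
  by (simp_all add: conj_conj)

lemma conj_eq_iff:
  "g \<in> carrier G \<Longrightarrow> x \<in> carrier G \<Longrightarrow> y \<in> carrier G \<Longrightarrow> conj g x = y \<longleftrightarrow> g \<otimes> x = y \<otimes> g"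
  unfolding conj_def by (metis inv_closed inv_solve_right m_closed m_assoc inv_inv)

lemma conj_cong_iff:
  assumes "g \<in> carrier G" "h \<in> carrier G" "x \<in> carrier G"
  shows "conj g x = conj h x \<longleftrightarrow> conj (inv g \<otimes> h) x = x"
  using assms by (metis conj_closed conj_conj conj_inv_conj(1) conj_inv_conj(2) inv_closed)

lemma conj_commute:
  "z \<in> center G \<Longrightarrow> g \<in> carrier G \<Longrightarrow> conj g z = z"
  by (simp add: center_def conj_eq_iff)

lemma centerI:
  "z \<in> carrier G \<Longrightarrow> (\<And>g. g \<in> carrier G \<Longrightarrow> z \<otimes> g = g \<otimes> z) \<Longrightarrow> z \<in> center G"
  by (simp add: center_def)

lemma center_closed: "z \<in> center G \<Longrightarrow> z \<in> carrier G"
  by (simp add: center_def)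

lemma center_commutes: "z \<in> center G \<Longrightarrow> g \<in> carrier G \<Longrightarrow> z \<otimes> g = g \<otimes> z"
  by (simp add: center_def)

lemma center_iff_conj:
  "z \<in> carrier G \<Longrightarrow> z \<in> center G \<longleftrightarrow> (\<forall>g \<in> carrier G. conj g z = z)"
  by (auto simp: center_def conj_eq_iff)

lemma center_subgroup: "subgroup (center G) G"
proof (rule subgroupI)
  show "inv z \<in> center G" if "z \<in> center G" for z
    using center_closed[OF that] conj_commute[OF that]
    by (simp add: center_iff_conj conj_inv)
  show "y \<otimes> z \<in> center G" if "y \<in> center G" "z \<in> center G" for y z
    using that[THEN center_closed] that[THEN conj_commute]
    by (simp add: center_iff_conj conj_mult)
qed (auto simp: center_def)

section \<open>Conjugacy classes and translation by central elements\<close>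

lemma cls_self: "x \<in> carrier G \<Longrightarrow> x \<in> cls x"
  unfolding cls_def by (rule image_eqI[of _ _ "\<one>"]) auto

lemma cls_closed: "x \<in> carrier G \<Longrightarrow> cls x \<subseteq> carrier G"
  by (auto simp: cls_def)

lemma conj_in_cls:
  "x \<in> carrier G \<Longrightarrow> y \<in> cls x \<Longrightarrow> g \<in> carrier G \<Longrightarrow> conj g y \<in> cls x"
  by (auto simp: cls_def conj_conj)

lemma cls_eq:
  assumes x: "x \<in> carrier G" and y: "y \<in> cls x" shows "cls y = cls x"
proof -
  obtain g where g: "g \<in> carrier G" "y = conj g x" using y by (auto simp: cls_def)
  then have y': "y \<in> carrier G" and "conj (inv g) y = x" using x by auto
  then have "x \<in> cls y" using g(1) unfolding cls_def by blast
  have "cls y \<subseteq> cls x" unfolding cls_def[of y] using conj_in_cls[OF x y] by blast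
  moreover have "cls x \<subseteq> cls y"
    unfolding cls_def[of x] using conj_in_cls[OF y' \<open>x \<in> cls y\<close>] by blast
  ultimately show ?thesis by blast
qed

lemma cls_center:
  assumes "x \<in> center G" shows "cls x = {x}"
proof -
  have "cls x = (\<lambda>g. x) ` carrier G"
    unfolding cls_def by (rule image_cong) (simp_all add: conj_commute[OF assms])
  then show ?thesis by auto
qed

lemma cls_singleton: "x \<in> carrier G \<Longrightarrow> cls x \<subseteq> {x} \<Longrightarrow> x \<in> center G"
  by (auto simp: center_iff_conj cls_def)

lemma cls_mult_center:
  assumes "z \<in> center G" "x \<in> carrier G"
  shows "cls (z \<otimes> x) = (\<lambda>y. z \<otimes> y) ` cls x"
  unfolding cls_def image_image
  using assms(2) center_closed[OF assms(1)] conj_commute[OF assms(1)]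
  by (intro image_cong) (simp_all add: conj_mult)

lemma card_cls_mult_center:
  assumes "z \<in> center G" "x \<in> carrier G"
  shows "card (cls (z \<otimes> x)) = card (cls x)"
  unfolding cls_mult_center[OF assms]
  by (rule card_image)
    (meson assms center_closed cls_closed inj_onI l_cancel subset_iff)

lemma cs_eq: "cs G = (\<lambda>x. card (cls x)) ` carrier G"
proof -
  have "orbit G (\<lambda>g. \<lambda>h \<in> carrier G. g \<otimes> h \<otimes> inv g) x = cls x" if "x \<in> carrier G" for x
    using that by (auto simp: orbit_def cls_def conj_def)
  then show ?thesis
    unfolding cs_def conj_classes_def orbits_def by force
qed

text \<open>Orbit-stabilizer counting for any map whose fibres are the left cosets of
  \<open>D\<close>. This generality covers both a single class and the orbit of a pair of
  elements.\<close>

lemma card_fibres: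
  assumes fin: "finite (carrier G)" and D: "subgroup D G"
    and f: "\<And>g h. g \<in> carrier G \<Longrightarrow> h \<in> carrier G \<Longrightarrow> f g = f h \<longleftrightarrow> inv g \<otimes> h \<in> D"
  shows "card (f ` carrier G) * card D = card (carrier G)"
proof -
  interpret D: subgroup D G by (rule D)
  have "card {g \<in> carrier G. f g = y} = card D" if y: "y \<in> f ` carrier G" for y
  proof -
    obtain h where h: "h \<in> carrier G" "y = f h" using y by blast
    have "{g \<in> carrier G. f g = y} = (\<lambda>d. h \<otimes> d) ` D"
    proof (rule Set.set_eqI)
      fix g
      show "g \<in> {g \<in> carrier G. f g = y} \<longleftrightarrow> g \<in> (\<lambda>d. h \<otimes> d) ` D"
      proof
        assume "g \<in> {g \<in> carrier G. f g = y}"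
        then have g: "g \<in> carrier G" and "f h = f g" using h(2) by simp_all
        then have "inv h \<otimes> g \<in> D" using f[OF h(1) g] by blast
        then show "g \<in> (\<lambda>d. h \<otimes> d) ` D"
          using h(1) g by (intro image_eqI[of _ _ "inv h \<otimes> g"]) (simp_all add: inv_cancel_left)
      next
        assume "g \<in> (\<lambda>d. h \<otimes> d) ` D"
        then obtain d where d: "d \<in> D" "g = h \<otimes> d" by blast
        then have g: "g \<in> carrier G" and "inv h \<otimes> g \<in> D"
          using h(1) by (simp_all add: inv_cancel_left)
        then have "f h = f g" using f[OF h(1) g] by blast
        then show "g \<in> {g \<in> carrier G. f g = y}" using g h(2) by simp
      qed
    qed
    moreover have "inj_on (\<lambda>d. h \<otimes> d) D"
      using h(1) by (meson D.mem_carrier inj_onI l_cancel)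
    ultimately show ?thesis by (simp only: card_image)
  qed
  then have "(\<Sum>y \<in> f ` carrier G. card {g \<in> carrier G. f g = y}) = card (f ` carrier G) * card D"
    by simp
  moreover have "card (carrier G) = (\<Sum>y \<in> f ` carrier G. card {g \<in> carrier G. f g = y})"
    using sum.image_gen[OF fin, of "\<lambda>_. 1::nat" f] by simp
  ultimately show ?thesis by argo
qed

lemma card_subgroup_dvd:
  assumes A: "subgroup A G" and H: "subgroup H G" and AH: "A \<subseteq> H"
  shows "card A dvd card H"
proof -
  interpret GH: group "G\<lparr>carrier := H\<rparr>"
    by (rule subgroup.subgroup_is_group[OF H]) (rule group_axioms)
  from GH.lagrange[OF subgroup_incl[OF A H AH]] show ?thesis
    by (simp add: order_def dvd_def) (metis mult.commute)
qed

lemma centralizer_subgroup: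
  assumes "x \<in> carrier G" shows "subgroup {g \<in> carrier G. conj g x = x} G"
proof (rule subgroupI)
  show "inv g \<in> {g \<in> carrier G. conj g x = x}" if "g \<in> {g \<in> carrier G. conj g x = x}" for g
    using that assms conj_inv_conj(1)[of g x] by auto
next
  show "g \<otimes> h \<in> {g \<in> carrier G. conj g x = x}"
    if "g \<in> {g \<in> carrier G. conj g x = x}" "h \<in> {g \<in> carrier G. conj g x = x}" for g h
    using that assms by (auto simp flip: conj_conj)
next
  show "{g \<in> carrier G. conj g x = x} \<noteq> {}" using assms by (auto intro: exI[of _ \<one>])
qed auto

end

section \<open>Pairs of elements with coprime class sizes\<close>

locale finite_group = group +
  assumes finite_carrier: "finite (carrier G)"
begin

lemma finite_cls: "x \<in> carrier G \<Longrightarrow> finite (cls x)"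
  using cls_closed finite_carrier finite_subset by blast

lemma card_cls_pos: "x \<in> carrier G \<Longrightarrow> card (cls x) > 0"
  using finite_cls cls_self card_gt_0_iff by blast

lemma card_cls_eq_1_iff: "x \<in> carrier G \<Longrightarrow> card (cls x) = 1 \<longleftrightarrow> x \<in> center G"
proof
  assume x: "x \<in> carrier G" and "card (cls x) = 1"
  then obtain y where "cls x = {y}" using card_1_singletonE by blast
  then show "x \<in> center G" using x cls_self[OF x] by (intro cls_singleton) auto
qed (simp add: cls_center)

text \<open>The stabilizer of the pair has index divisible by both class sizes, so its orbit is the full
  product of the two classes.\<close>
lemma simultaneous_conj:
  assumes x: "x \<in> carrier G" and y: "y \<in> carrier G"
    and cop: "coprime (card (cls x)) (card (cls y))"
    and u: "u \<in> cls x" and v: "v \<in> cls y"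
  shows "\<exists>g \<in> carrier G. u = conj g x \<and> v = conj g y"
proof -
  define A where "A = {g \<in> carrier G. conj g x = x}"
  define B where "B = {g \<in> carrier G. conj g y = y}"
  have sA: "subgroup A G" and sB: "subgroup B G"
    unfolding A_def B_def using x y by (auto intro: centralizer_subgroup)
  then have sAB: "subgroup (A \<inter> B) G" by (rule subgroups_Inter_pair)
  have A: "card (cls x) * card A = card (carrier G)"
    unfolding cls_def
    by (rule card_fibres[OF finite_carrier sA]) (use x in \<open>auto simp: conj_cong_iff A_def\<close>)
  have B: "card (cls y) * card B = card (carrier G)"
    unfolding cls_def
    by (rule card_fibres[OF finite_carrier sB]) (use y in \<open>auto simp: conj_cong_iff B_def\<close>)
  let ?f = "\<lambda>g. (conj g x, conj g y)"
  have AB: "card (?f ` carrier G) * card (A \<inter> B) = card (carrier G)"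
    by (rule card_fibres[OF finite_carrier sAB])
      (use x y in \<open>auto simp: conj_cong_iff A_def B_def\<close>)
  have pos: "card (A \<inter> B) > 0"
    using subgroup.finite_imp_card_positive[OF sAB finite_carrier] .
  \<comment> \<open>The index of a subgroup is a multiple of the index of every larger
    subgroup.\<close>
  have arith: "a dvd p" if "a * c = n" "d dvd c" "p * d = n" "d > 0" for a c d n p :: nat
    using that by (metis dvd_times_right_cancel_iff mult_dvd_mono dvd_refl neq0_conv)
  have "card (cls x) dvd card (?f ` carrier G)"
    by (rule arith[OF A card_subgroup_dvd[OF sAB sA] AB pos]) blast
  moreover have "card (cls y) dvd card (?f ` carrier G)"
    by (rule arith[OF B card_subgroup_dvd[OF sAB sB] AB pos]) blast
  ultimately have "card (cls x) * card (cls y) dvd card (?f ` carrier G)"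
    using cop divides_mult by blast
  moreover have "card (?f ` carrier G) > 0"
    using finite_carrier by (auto simp: card_gt_0_iff)
  ultimately have "card (cls x \<times> cls y) \<le> card (?f ` carrier G)"
    by (simp add: card_cartesian_product dvd_imp_le)
  moreover have "?f ` carrier G \<subseteq> cls x \<times> cls y" by (auto simp: cls_def)
  moreover have "finite (cls x \<times> cls y)" using finite_cls x y by simp
  ultimately have "?f ` carrier G = cls x \<times> cls y" by (meson card_seteq)
  then have "(u, v) \<in> ?f ` carrier G" using u v by simp
  then show ?thesis by blast
qed

lemma cls_mult:
  assumes "x \<in> carrier G" "y \<in> carrier G"
    and "coprime (card (cls x)) (card (cls y))" "u \<in> cls x" "v \<in> cls y"
  shows "u \<otimes> v \<in> cls (x \<otimes> y)"
proof -
  from simultaneous_conj[OF assms] obtain g where "g \<in> carrier G" "u = conj g x" "v = conj g y"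
    by blast
  then show ?thesis using assms unfolding cls_def by (auto simp: conj_mult)
qed

text \<open>In a finite group the inverse of an element is its power with exponent
  \<open>order G - 1\<close>.\<close>

lemma finite_closed_subgroup:
  assumes "H \<subseteq> carrier G" "\<one> \<in> H" "\<And>x y. x \<in> H \<Longrightarrow> y \<in> H \<Longrightarrow> x \<otimes> y \<in> H"
  shows "subgroup H G"
proof (rule subgroupI)
  fix x assume x: "x \<in> H"
  then have xc: "x \<in> carrier G" using assms(1) by auto
  have pow: "x [^] (n::nat) \<in> H" for n by (induction n) (auto simp: assms x)
  have "order G > 0" using finite_carrier by (auto simp: order_def card_gt_0_iff)
  then obtain m where m: "order G = Suc m" by (cases "order G") auto
  have "x [^] m \<otimes> x = \<one>" using pow_order_eq_1[OF xc] m by simp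
  then have "inv x = x [^] m" using xc by (metis inv_equality nat_pow_closed)
  then show "inv x \<in> H" using pow by simp
qed (use assms in auto)

section \<open>Right stabilizers\<close>

lemma rstabD: "s \<in> rstab A \<Longrightarrow> s \<in> carrier G" "s \<in> rstab A \<Longrightarrow> u \<in> A \<Longrightarrow> u \<otimes> s \<in> A"
  unfolding rstab_def by blast+

lemma rstabI: "s \<in> carrier G \<Longrightarrow> (\<And>u. u \<in> A \<Longrightarrow> u \<otimes> s \<in> A) \<Longrightarrow> s \<in> rstab A"
  unfolding rstab_def by blast

lemma rstab_subgroup:
  assumes A: "A \<subseteq> carrier G" shows "subgroup (rstab A) G"
proof (rule finite_closed_subgroup)
  show "rstab A \<subseteq> carrier G" using rstabD(1) by blast
  show "\<one> \<in> rstab A"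
  proof (rule rstabI)
    show "u \<otimes> \<one> \<in> A" if "u \<in> A" for u using that A by (simp add: subsetD)
  qed simp
  show "s \<otimes> t \<in> rstab A" if st: "s \<in> rstab A" "t \<in> rstab A" for s t
  proof (rule rstabI)
    show "u \<otimes> (s \<otimes> t) \<in> A" if u: "u \<in> A" for u
    proof -
      have "u \<otimes> s \<otimes> t \<in> A" by (intro rstabD(2) st u)
      then show ?thesis using A u st[THEN rstabD(1)] by (simp add: m_assoc subsetD)
    qed
  qed (use st[THEN rstabD(1)] in simp)
qed

text \<open>\<open>A\<close> is a disjoint union of left cosets of its right stabilizer.\<close>

lemma card_rstab_dvd:
  assumes A: "A \<subseteq> carrier G" shows "card (rstab A) dvd card A"
proof -
  interpret S: subgroup "rstab A" G by (rule rstab_subgroup[OF A])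
  have sub: "u <# rstab A \<subseteq> A" if "u \<in> A" for u
    unfolding l_coset_def using rstabD(2)[OF _ that] by blast
  define C where "C = (\<lambda>u. u <# rstab A) ` A"
  have coset: "c \<in> lcosets rstab A" if "c \<in> C" for c
    using that A by (auto simp: C_def LCOSETS_def)
  have "u \<in> u <# rstab A" if "u \<in> A" for u
    unfolding l_coset_def using that A S.one_closed by force
  then have UC: "\<Union>C = A" using sub unfolding C_def by blast
  have "card (rstab A) dvd card (\<Union>C)"
  proof (rule dvd_partition)
    show "finite (\<Union>C)"
      unfolding UC using A finite_carrier by (rule finite_subset)
    show "\<forall>c\<in>C. card (rstab A) dvd card c"
      using l_card_cosets_equal[OF coset S.subset finite_carrier] by simp
    show "\<forall>c1\<in>C. \<forall>c2\<in>C. c1 \<noteq> c2 \<longrightarrow> c1 \<inter> c2 = {}"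
      using lcos_disjoint[OF S.is_subgroup] coset
      by (simp add: disjoint_def pairwise_def disjnt_def)
  qed
  then show ?thesis unfolding UC .
qed

text \<open>A class is permuted by every conjugation, so its stabilizer is normal.\<close>

lemma conj_rstab:
  assumes x: "x \<in> carrier G" and s: "s \<in> rstab (cls x)" and g: "g \<in> carrier G"
  shows "conj g s \<in> rstab (cls x)"
proof -
  have sc: "s \<in> carrier G" using s by (simp add: rstab_def)
  have "u \<otimes> conj g s \<in> cls x" if u: "u \<in> cls x" for u
  proof -
    have uc: "u \<in> carrier G" using u cls_closed[OF x] by auto
    have "conj (inv g) u \<otimes> s \<in> cls x"
      using s conj_in_cls[OF x u, of "inv g"] g by (simp add: rstab_def)
    from conj_in_cls[OF x this g] show ?thesis
      using g uc sc by (simp add: conj_mult)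
  qed
  then show ?thesis using g sc by (simp add: rstab_def)
qed

text \<open>The right translates of \<open>cls x\<close> by \<open>v\<close> and by \<open>w\<close>
  both lie in the class of \<open>x \<otimes> y\<close>. By maximality of \<open>cls x\<close> that
  class has no room for more, so the two translates coincide, and translating back by the inverse of
  \<open>w\<close> fixes \<open>cls x\<close>.\<close>

lemma mult_inv_in_rstab:
  assumes x: "x \<in> carrier G" and y: "y \<in> carrier G"
    and cop: "coprime (card (cls x)) (card (cls y))"
    and max: "\<And>g. g \<in> carrier G \<Longrightarrow> card (cls g) \<le> card (cls x)"
    and v: "v \<in> cls y" and w: "w \<in> cls y"
  shows "v \<otimes> inv w \<in> rstab (cls x)"
proof -
  have vc: "v \<in> carrier G" and wc: "w \<in> carrier G" using v w cls_closed[OF y] by auto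
  have img: "(\<lambda>u. u \<otimes> t) ` cls x = cls (x \<otimes> y)" if t: "t \<in> cls y" for t
  proof (rule card_seteq)
    have tc: "t \<in> carrier G" using t cls_closed[OF y] by auto
    show "finite (cls (x \<otimes> y))" using x y finite_cls by simp
    show "(\<lambda>u. u \<otimes> t) ` cls x \<subseteq> cls (x \<otimes> y)"
      using cls_mult[OF x y cop] t by auto
    have "inj_on (\<lambda>u. u \<otimes> t) (cls x)"
      using tc cls_closed[OF x] by (auto simp: inj_on_def subset_iff)
    then show "card (cls (x \<otimes> y)) \<le> card ((\<lambda>u. u \<otimes> t) ` cls x)"
      using max[of "x \<otimes> y"] x y by (simp add: card_image)
  qed
  have "u \<otimes> (v \<otimes> inv w) \<in> cls x" if u: "u \<in> cls x" for u
  proof -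
    have uc: "u \<in> carrier G" using u cls_closed[OF x] by auto
    have "u \<otimes> v \<in> (\<lambda>u. u \<otimes> w) ` cls x" using img[OF v] img[OF w] u by auto
    then obtain u' where u': "u' \<in> cls x" "u \<otimes> v = u' \<otimes> w" by auto
    then have "u' = u \<otimes> (v \<otimes> inv w)"
      using uc vc wc cls_closed[OF x] by (metis inv_closed inv_solve_right m_assoc m_closed subsetD)
    then show ?thesis using u' by simp
  qed
  then show ?thesis using vc wc by (simp add: rstab_def)
qed

end

section \<open>Class sizes in arithmetic progression\<close>

context finite_group
begin

lemma cls_subset_rcoset_rstab:
  assumes x: "x \<in> carrier G" and y: "y \<in> carrier G"
    and cop: "coprime (card (cls x)) (card (cls y))"
    and max: "\<And>g. g \<in> carrier G \<Longrightarrow> card (cls g) \<le> card (cls x)"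
  shows "cls y \<subseteq> rstab (cls x) #> y"
proof
  fix v assume v: "v \<in> cls y"
  then have vc: "v \<in> carrier G" using cls_closed[OF y] by blast
  have "v \<otimes> inv y \<in> rstab (cls x)"
    by (rule mult_inv_in_rstab[OF x y cop max v cls_self[OF y]])
  moreover have "v = (v \<otimes> inv y) \<otimes> y" using vc y by (simp add: m_assoc)
  ultimately show "v \<in> rstab (cls x) #> y" unfolding r_coset_def by blast
qed

text \<open>The stabilizer is normal and its coset of \<open>y\<close> contains
  \<open>cls y\<close>, so the coset is invariant under conjugation; hence so is what remains after
  removing the class.\<close>

lemma cls_subset_rcoset_remainder:
  assumes x: "x \<in> carrier G" and y: "y \<in> carrier G"
    and cop: "coprime (card (cls x)) (card (cls y))"
    and max: "\<And>g. g \<in> carrier G \<Longrightarrow> card (cls g) \<le> card (cls x)"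
    and w: "w \<in> (rstab (cls x) #> y) - cls y"
  shows "cls w \<subseteq> (rstab (cls x) #> y) - cls y"
proof
  let ?S = "rstab (cls x)"
  interpret S: subgroup ?S G by (rule rstab_subgroup[OF cls_closed[OF x]])
  obtain s where s: "s \<in> ?S" "w = s \<otimes> y" using w unfolding r_coset_def by blast
  have sc: "s \<in> carrier G" by (rule rstabD(1)[OF s(1)])
  have wc: "w \<in> carrier G" using s(2) sc y by simp
  fix w' assume w': "w' \<in> cls w"
  then obtain g where g: "g \<in> carrier G" "w' = conj g w" unfolding cls_def by blast
  have cy: "conj g y \<in> cls y" by (rule conj_in_cls[OF y cls_self[OF y] g(1)])
  have "conj g s \<otimes> (conj g y \<otimes> inv y) \<in> ?S"
    by (intro S.m_closed conj_rstab[OF x s(1) g(1)]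
        mult_inv_in_rstab[OF x y cop max cy cls_self[OF y]])
  moreover have "w' = conj g s \<otimes> (conj g y \<otimes> inv y) \<otimes> y"
    unfolding g(2) s(2) using g(1) sc y by (simp add: conj_mult m_assoc)
  ultimately have "w' \<in> ?S #> y" unfolding r_coset_def by blast
  moreover have "w' \<notin> cls y"
  proof
    assume "w' \<in> cls y"
    from conj_in_cls[OF y this, of "inv g"] have "w \<in> cls y" using g wc by simp
    then show False using w by blast
  qed
  ultimately show "w' \<in> (?S #> y) - cls y" by blast
qed

lemma card_rcoset_rstab:
  assumes x: "x \<in> carrier G" and y: "y \<in> carrier G"
  shows "card (rstab (cls x) #> y) = card (rstab (cls x))"
proof (rule card_rcosets_equal[symmetric])
  have sub: "rstab (cls x) \<subseteq> carrier G" using rstabD(1) by blast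
  then show "rstab (cls x) \<subseteq> carrier G" .
  show "rstab (cls x) #> y \<in> rcosets rstab (cls x)"
    unfolding RCOSETS_def using y by blast
qed

lemma finite_rstab: "finite (rstab A)"
  using finite_carrier rstabD(1) by (meson finite_subset subsetI)

text \<open>The classes filling up the coset of \<open>y\<close> have size at most \<open>card (rstab (cls x)) - card (cls y)\<close>.\<close>
lemma rcoset_remainder_central:
  assumes x: "x \<in> carrier G" and y: "y \<in> carrier G"
    and cop: "coprime (card (cls x)) (card (cls y))"
    and max: "\<And>g. g \<in> carrier G \<Longrightarrow> card (cls g) \<le> card (cls x)"
    and gap: "\<And>g. g \<in> carrier G \<Longrightarrow> card (cls g) + card (cls y) \<le> card (rstab (cls x)) \<Longrightarrow> g \<in> center G"
    and w: "w \<in> (rstab (cls x) #> y) - cls y"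
  shows "w \<in> center G"
proof (rule gap)
  let ?S = "rstab (cls x)"
  have Sc: "?S \<subseteq> carrier G" using rstabD(1) by blast
  then show wc: "w \<in> carrier G" using w r_coset_subset_G[OF Sc y] by blast
  have fin: "finite (?S #> y)"
    using r_coset_subset_G[OF Sc y] finite_carrier by (rule finite_subset)
  have "card (cls w) + card (cls y) = card (cls w \<union> cls y)"
    using cls_subset_rcoset_remainder[OF x y cop max w] finite_cls wc y
    by (intro card_Un_disjoint[symmetric]) blast+
  also have "\<dots> \<le> card (?S #> y)"
    using cls_subset_rcoset_remainder[OF x y cop max w] cls_subset_rcoset_rstab[OF x y cop max]
    by (intro card_mono[OF fin]) blast
  finally show "card (cls w) + card (cls y) \<le> card ?S"
    unfolding card_rcoset_rstab[OF x y] .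
qed

text \<open>With M and m the class sizes of \<open>x\<close> and \<open>y\<close>, the progression
  enters only through coprimality, m < M < 2 m, and the absence of noncentral classes of size at
  most M - m. The element \<open>k\<close> is \<open>y\<close> moved into the stabilizer by a
  central factor.\<close>

lemma rstab_of_largest_class:
  assumes x: "x \<in> carrier G" and y: "y \<in> carrier G"
    and cop: "coprime (card (cls x)) (card (cls y))"
    and max: "\<And>g. g \<in> carrier G \<Longrightarrow> card (cls g) \<le> card (cls x)"
    and y1: "1 < card (cls y)" and lt: "card (cls y) < card (cls x)"
    and lt2: "card (cls x) < 2 * card (cls y)"
    and gap: "\<And>g. g \<in> carrier G \<Longrightarrow> card (cls g) + card (cls y) \<le> card (cls x) \<Longrightarrow> g \<in> center G"
  obtains k where "k \<in> carrier G" "card (cls k) = card (cls y)" "\<one> \<notin> cls k"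
    "rstab (cls x) = insert \<one> (cls k)" "card (rstab (cls x)) = card (cls x)"
    "card (cls x) = Suc (card (cls y))"
proof -
  define S where "S = rstab (cls x)"
  interpret S: subgroup S G unfolding S_def by (rule rstab_subgroup[OF cls_closed[OF x]])
  define R where "R = (S #> y) - cls y"
  have fin: "finite (S #> y)"
    using r_coset_subset_G[OF S.subset y] finite_carrier by (rule finite_subset)
  have sub: "cls y \<subseteq> S #> y" unfolding S_def by (rule cls_subset_rcoset_rstab[OF x y cop max])
  have cS: "card (S #> y) = card S" unfolding S_def by (rule card_rcoset_rstab[OF x y])
  \<comment> \<open>A proper divisor of \<open>card (cls x)\<close> is at most half of it, which is
    less than \<open>card (cls y)\<close>.\<close>
  have "card (cls y) \<le> card S" using card_mono[OF fin sub] cS by simp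
  moreover have "card S dvd card (cls x)"
    unfolding S_def by (rule card_rstab_dvd[OF cls_closed[OF x]])
  ultimately have SM: "card S = card (cls x)"
  proof -
    assume a: "card (cls y) \<le> card S" and "card S dvd card (cls x)"
    then obtain q where q: "card (cls x) = card S * q" by (elim dvdE)
    have "q < 2"
    proof (rule ccontr)
      assume "\<not> q < 2"
      then have "card S * 2 \<le> card S * q" by simp
      then show False using a q lt2 by linarith
    qed
    moreover have "q \<noteq> 0" using q lt by (intro notI) simp
    ultimately have "q = 1" by simp
    then show ?thesis using q by simp
  qed
  have R_center: "w \<in> center G" if "w \<in> R" for w
  proof (rule rcoset_remainder_central[OF x y cop max])
    show "g \<in> center G"
      if "g \<in> carrier G" "card (cls g) + card (cls y) \<le> card (rstab (cls x))" for g
      using gap that SM unfolding S_def by simp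
  qed (use that in \<open>simp_all add: R_def S_def\<close>)
  have cR: "card R = card (cls x) - card (cls y)"
    unfolding R_def using card_Diff_subset[OF finite_cls[OF y] sub] cS SM by simp
  then have "R \<noteq> {}" using lt by (intro notI) simp
  then obtain z where z: "z \<in> R" by blast
  then have zc: "z \<in> center G" by (rule R_center)
  then have zG: "z \<in> carrier G" by (rule center_closed)
  have Sz: "S #> z = S #> y"
    using z repr_independence[OF _ y S.is_subgroup] unfolding R_def by simp
  \<comment> \<open>Since \<open>z\<close> is a central element of the coset of \<open>y\<close>,
    dividing by it carries \<open>y\<close> into \<open>S\<close> without changing the class
    size.\<close>
  define k where "k = inv z \<otimes> y"
  have izc: "inv z \<in> center G" by (rule subgroup.m_inv_closed[OF center_subgroup zc])
  have kG: "k \<in> carrier G" unfolding k_def using zG y by simp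
  have ck: "card (cls k) = card (cls y)"
    unfolding k_def by (rule card_cls_mult_center[OF izc y])
  have kS: "k \<in> S"
  proof -
    have "y \<in> S #> z" unfolding Sz by (rule rcos_self[OF y S.is_subgroup])
    then obtain s where s: "s \<in> S" "y = s \<otimes> z" unfolding r_coset_def by blast
    have sG: "s \<in> carrier G" by (rule S.mem_carrier[OF s(1)])
    have "k = s"
      unfolding k_def s(2) using sG zG center_commutes[OF izc, of "s \<otimes> z"] by (simp add: m_assoc)
    then show ?thesis using s(1) by simp
  qed
  define D where "D = S \<inter> center G"
  have sD: "subgroup D G"
    unfolding D_def by (rule subgroups_Inter_pair[OF S.is_subgroup center_subgroup])
  \<comment> \<open>Both sides are the set of central elements of the coset of \<open>y\<close>:
    \<open>cls y\<close> contains none, as it has more than one element, and \<open>R\<close>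
    consists of nothing else.\<close>
  have "(\<lambda>s. s \<otimes> z) ` D = R"
  proof
    show "(\<lambda>s. s \<otimes> z) ` D \<subseteq> R"
    proof
      fix w assume "w \<in> (\<lambda>s. s \<otimes> z) ` D"
      then obtain s where s: "s \<in> S" "s \<in> center G" "w = s \<otimes> z" unfolding D_def by blast
      have wc: "w \<in> center G"
        unfolding s(3) by (rule subgroup.m_closed[OF center_subgroup s(2) zc])
      have "w \<notin> cls y"
      proof
        assume "w \<in> cls y"
        from cls_eq[OF y this] y1 have "cls y = {w}" by (simp add: cls_center[OF wc])
        then show False using y1 by simp
      qed
      moreover have "w \<in> S #> z" unfolding r_coset_def using s(1,3) by blast
      then have "w \<in> S #> y" unfolding Sz .
      ultimately show "w \<in> R" unfolding R_def by blast
    qed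
    show "R \<subseteq> (\<lambda>s. s \<otimes> z) ` D"
    proof
      fix w assume w: "w \<in> R"
      then have "w \<in> S #> z" unfolding R_def Sz by blast
      then obtain s where s: "s \<in> S" "w = s \<otimes> z" unfolding r_coset_def by blast
      have "s = w \<otimes> inv z" using s(2) zG S.mem_carrier[OF s(1)] by (simp add: m_assoc)
      then have "s \<in> center G"
        using subgroup.m_closed[OF center_subgroup R_center[OF w] izc] by simp
      then show "w \<in> (\<lambda>s. s \<otimes> z) ` D" using s unfolding D_def by blast
    qed
  qed
  moreover have "inj_on (\<lambda>s. s \<otimes> z) D"
    using zG S.mem_carrier unfolding D_def by (intro inj_onI) (metis IntD1 r_cancel)
  ultimately have cD: "card D = card (cls x) - card (cls y)" using cR by (metis card_image)
  \<comment> \<open>By Lagrange the difference of the two coprime sizes divides the larger one,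
    hence also the smaller one, so it is 1.\<close>
  have "card D dvd card (cls x)"
    using card_subgroup_dvd[OF sD S.is_subgroup] SM unfolding D_def by simp
  moreover from this have "card D dvd card (cls y)"
    using dvd_diff_nat[of "card D" "card (cls x)" "card D"] cD lt by simp
  ultimately have D1: "card D = 1" using cop by (metis coprime_common_divisor_nat)
  then have M: "card (cls x) = Suc (card (cls y))" using cD lt by simp
  have 1: "\<one> \<notin> cls k"
  proof
    assume "\<one> \<in> cls k"
    from cls_eq[OF kG this] have "card (cls k) = 1"
      by (metis card_1_singleton_iff cls_center subgroup.one_closed[OF center_subgroup] One_nat_def)
    then show False using ck y1 by simp
  qed
  have "insert \<one> (cls k) = S"
  proof (rule card_subset_eq)
    show "finite S" unfolding S_def by (rule finite_rstab)
    have "cls k \<subseteq> S"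
      using conj_rstab[OF x kS[unfolded S_def]] unfolding cls_def[of k] S_def by blast
    then show "insert \<one> (cls k) \<subseteq> S" using S.one_closed by blast
    show "card (insert \<one> (cls k)) = card S" using 1 finite_cls[OF kG] ck M SM by simp
  qed
  then show thesis using that[OF kG ck 1] SM M unfolding S_def by simp
qed

text \<open>The product map from \<open>cls w\<close> and \<open>cls k\<close> into the class of
  \<open>w \<otimes> k\<close> turns out to be injective. With s = \<open>card (cls k)\<close> this
  gives (s - 1) s <= s + 1, which fails for s >= 3.\<close>

lemma no_class_below:
  assumes k: "k \<in> carrier G" and S: "subgroup (insert \<one> (cls k)) G" and k1: "\<one> \<notin> cls k"
    and max: "\<And>g. g \<in> carrier G \<Longrightarrow> card (cls g) \<le> Suc (card (cls k))"
    and w: "w \<in> carrier G" and cw: "Suc (card (cls w)) = card (cls k)" and w1: "1 < card (cls w)"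
  shows False
proof -
  interpret S: subgroup "insert \<one> (cls k)" G by (rule S)
  have cop: "coprime (card (cls w)) (card (cls k))"
    unfolding cw[symmetric] by simp
  define P where "P = cls (w \<otimes> k)"
  have P: "u \<otimes> v \<in> P" if "u \<in> cls w" "v \<in> cls k" for u v
    unfolding P_def by (rule cls_mult[OF w k cop that])
  \<comment> \<open>If the two classes met they would coincide, and
    \<open>insert \<one> (cls k)\<close> would stabilize \<open>cls w\<close>, a nonempty set with
    fewer elements than this subgroup.\<close>
  have disj: "u \<notin> P" if u: "u \<in> cls w" for u
  proof
    assume "u \<in> P"
    then have "P = cls w"
      using cls_eq[OF w u] cls_eq[of "w \<otimes> k" u] w k unfolding P_def by simp
    then have "v \<in> rstab (cls w)" if "v \<in> cls k" for v
      using P that cls_closed[OF k] by (intro rstabI) blast+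
    then have "insert \<one> (cls k) \<subseteq> rstab (cls w)"
      using subgroup.one_closed[OF rstab_subgroup[OF cls_closed[OF w]]] by blast
    then have "card (insert \<one> (cls k)) \<le> card (rstab (cls w))"
      by (rule card_mono[OF finite_rstab])
    also have "\<dots> \<le> card (cls w)"
      using card_rstab_dvd[OF cls_closed[OF w]] card_cls_pos[OF w] by (rule dvd_imp_le)
    finally show False using k1 finite_cls[OF k] cw by simp
  qed
  \<comment> \<open>For equal products, \<open>u\<close> is \<open>u'\<close> times the quotient of
    \<open>v'\<close> and \<open>v\<close>, an element of the subgroup. If that quotient were in
    \<open>cls k\<close>, then \<open>u\<close> would lie in \<open>P\<close>.\<close>
  have "inj_on (\<lambda>(u, v). u \<otimes> v) (cls w \<times> cls k)"
  proof (rule inj_onI, clarify)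
    fix u v u' v'
    assume uv: "u \<in> cls w" "v \<in> cls k" "u' \<in> cls w" "v' \<in> cls k" and eq: "u \<otimes> v = u' \<otimes> v'"
    have c: "u \<in> carrier G" "v \<in> carrier G" "u' \<in> carrier G" "v' \<in> carrier G"
      using uv cls_closed[OF w] cls_closed[OF k] by blast+
    have u: "u = u' \<otimes> (v' \<otimes> inv v)"
      using c eq by (metis inv_closed inv_solve_right m_assoc m_closed)
    have "v' \<otimes> inv v \<in> insert \<one> (cls k)"
      using uv by (intro S.m_closed S.m_inv_closed) blast+
    moreover have "v' \<otimes> inv v \<notin> cls k"
      using P[OF uv(3), of "v' \<otimes> inv v"] disj[OF uv(1)] unfolding u[symmetric] by blast
    ultimately have "v' \<otimes> inv v = \<one>" by blast
    then have "u = u'" using u c by simp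
    then show "u = u' \<and> v = v'" using eq c by simp
  qed
  then have "card (cls w) * card (cls k) = card ((\<lambda>(u, v). u \<otimes> v) ` (cls w \<times> cls k))"
    by (simp add: card_image card_cartesian_product)
  also have "\<dots> \<le> card P"
    using P finite_cls[of "w \<otimes> k"] w k unfolding P_def by (intro card_mono) auto
  also have "\<dots> \<le> Suc (card (cls k))" unfolding P_def using max w k by simp
  finally have "card (cls w) * card (cls k) \<le> Suc (card (cls k))" .
  moreover have "2 * card (cls k) \<le> card (cls w) * card (cls k)" using w1 by simp
  ultimately show False using w1 cw by linarith
qed

text \<open>Besides the numbers, representatives of the two noncentral class sizes are handed on:
  the stabilizer of \<open>cls x\<close>, of order three, is the starting point for the structure of
  the group.\<close>

lemma arithmetic_progression:
  fixes a\<^sub>0 d r :: int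
  assumes a0: "a\<^sub>0 \<ge> 1" and d: "d \<ge> 1" and r: "r \<ge> 2"
    and cs: "int ` cs G = (\<lambda>i. a\<^sub>0 + i * d) ` {0..r}"
  obtains x k where "a\<^sub>0 = 1" "d = 1" "r = 2" "cs G = {1, 2, 3}"
    "x \<in> carrier G" "card (cls x) = 3" "k \<in> carrier G" "card (cls k) = 2"
    "\<one> \<notin> cls k" "rstab (cls x) = insert \<one> (cls k)"
proof -
  have sizes: "int ` (\<lambda>x. card (cls x)) ` carrier G = (\<lambda>i. a\<^sub>0 + i * d) ` {0..r}"
    using cs unfolding cs_eq .
  have size: "\<exists>i\<in>{0..r}. int (card (cls g)) = a\<^sub>0 + i * d" if "g \<in> carrier G" for g
    using that sizes by blast
  have elem: "\<exists>g\<in>carrier G. int (card (cls g)) = a\<^sub>0 + i * d" if "0 \<le> i" "i \<le> r" for i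
  proof -
    have "a\<^sub>0 + i * d \<in> (\<lambda>i. a\<^sub>0 + i * d) ` {0..r}" using that by (intro imageI) simp
    then show ?thesis unfolding sizes[symmetric] by force
  qed
  have a: "a\<^sub>0 = 1"
  proof -
    have "card (cls \<one>) = 1"
      using cls_center[OF subgroup.one_closed[OF center_subgroup]] by simp
    then obtain i where "0 \<le> i" "1 = a\<^sub>0 + i * d" using size[of \<one>] by force
    moreover from this have "0 \<le> i * d" using d by simp
    ultimately show ?thesis using a0 by linarith
  qed
  have max: "int (card (cls g)) \<le> 1 + r * d" if g: "g \<in> carrier G" for g
  proof -
    obtain i where i: "i \<in> {0..r}" "int (card (cls g)) = a\<^sub>0 + i * d" using size[OF g] by blast
    then have "i * d \<le> r * d" using d by (intro mult_right_mono) auto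
    then show ?thesis using i a by simp
  qed
  \<comment> \<open>The size following 1 in the progression is 1 + d.\<close>
  have small: "g \<in> center G" if g: "g \<in> carrier G" "int (card (cls g)) \<le> d" for g
  proof -
    obtain i where i: "i \<in> {0..r}" "int (card (cls g)) = a\<^sub>0 + i * d" using size[OF g(1)] by blast
    have "i = 0"
    proof (rule ccontr)
      assume "i \<noteq> 0"
      then have "1 * d \<le> i * d" using i d by (intro mult_right_mono) auto
      then show False using i a g by simp
    qed
    then show ?thesis using i a card_cls_eq_1_iff[OF g(1)] by simp
  qed
  obtain x where x: "x \<in> carrier G" "int (card (cls x)) = 1 + r * d"
    using elem[of r] r a by auto
  obtain y where y: "y \<in> carrier G" "int (card (cls y)) = 1 + (r - 1) * d"
    using elem[of "r - 1"] r a by auto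
  have rd: "r * d = (r - 1) * d + d" by (simp add: algebra_simps)
  \<comment> \<open>Here r >= 2 is used: the second largest size 1 + (r - 1) d exceeds d, which
    gives the factor-two bound required below.\<close>
  have rd2: "(r - 1) * d \<ge> 1 * d" using r d by (intro mult_right_mono) auto
  have "coprime (1 + r * d) (1 + (r - 1) * d)"
  proof (rule coprimeI)
    fix c assume c: "c dvd 1 + r * d" "c dvd 1 + (r - 1) * d"
    then have "c dvd (1 + r * d) - (1 + (r - 1) * d)" by (rule dvd_diff)
    then have "c dvd d" using rd by simp
    then have "c dvd (1 + r * d) - r * d" using c(1) by (intro dvd_diff) auto
    then show "is_unit c" by simp
  qed
  then have cop: "coprime (card (cls x)) (card (cls y))"
    using x y by (metis coprime_int_iff)
  obtain k where k: "k \<in> carrier G" "card (cls k) = card (cls y)" "\<one> \<notin> cls k"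
    "rstab (cls x) = insert \<one> (cls k)" "card (rstab (cls x)) = card (cls x)"
    "card (cls x) = Suc (card (cls y))"
  proof (rule rstab_of_largest_class[OF x(1) y(1) cop])
    show "card (cls g) \<le> card (cls x)" if "g \<in> carrier G" for g
      using max[OF that] x by linarith
    show "1 < card (cls y)" "card (cls y) < card (cls x)" "card (cls x) < 2 * card (cls y)"
      using x y rd rd2 d by linarith+
    show "g \<in> center G" if "g \<in> carrier G" "card (cls g) + card (cls y) \<le> card (cls x)" for g
      using that x y rd by (intro small) linarith+
  qed blast
  have d1: "d = 1" using k(6) x y rd by linarith
  have r2: "r = 2"
  proof (rule ccontr)
    assume "r \<noteq> 2"
    then have r3: "r \<ge> 3" using r by simp
    \<comment> \<open>With d = 1 this is a class of size r - 1, one less than that of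
      \<open>k\<close>, and it is noncentral because r >= 3.\<close>
    obtain w where w: "w \<in> carrier G" "int (card (cls w)) = 1 + (r - 2) * d"
      using elem[of "r - 2"] r a by auto
    show False
    proof (rule no_class_below[OF k(1) _ k(3) _ w(1)])
      show "subgroup (insert \<one> (cls k)) G"
        unfolding k(4)[symmetric] by (rule rstab_subgroup[OF cls_closed[OF x(1)]])
      show "card (cls g) \<le> Suc (card (cls k))" if "g \<in> carrier G" for g
        using max[OF that] x k by linarith
      show "Suc (card (cls w)) = card (cls k)" "1 < card (cls w)"
        using w y k d1 r3 by simp_all
    qed
  qed
  have "cs G = {1, 2, 3}"
  proof -
    have "{0..2::int} = {0, 1, 2}" by auto
    then have "(\<lambda>i. a\<^sub>0 + i * d) ` {0..r} = int ` {1, 2, 3}" unfolding a d1 r2 by simp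
    then have "int ` cs G = int ` {1, 2, 3}" unfolding cs .
    then show ?thesis by (simp only: inj_image_eq_iff[OF inj_of_nat])
  qed
  moreover have "card (cls x) = 3" "card (cls k) = 2" using x y k d1 r2 by simp_all
  ultimately show thesis by (intro that[OF a d1 r2 _ x(1) _ k(1) _ k(3,4)])
qed

end

section \<open>Class sizes one, two and three\<close>

context finite_group
begin

text \<open>Writing S for {1, k, k^-1}, the conclusion says that Z(G) S has index two with
  \<open>x\<close> in the other coset, and that \<open>x\<close> inverts S and has central
  square.\<close>

lemma class_sizes_123:
  assumes sizes: "\<And>g. g \<in> carrier G \<Longrightarrow> card (cls g) \<in> {1, 2, 3}"
    and x: "x \<in> carrier G" "card (cls x) = 3" and k: "k \<in> carrier G" "card (cls k) = 2"
    and k1: "\<one> \<notin> cls k" and stab: "rstab (cls x) = insert \<one> (cls k)"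
  shows "k \<noteq> \<one> \<and> k \<otimes> k = inv k \<and> conj x k = inv k \<and> x \<otimes> x \<in> center G \<and>
    (\<forall>g\<in>carrier G. \<exists>z\<in>center G. \<exists>c\<in>{\<one>, k, inv k}. g = z \<otimes> c \<or> g = x \<otimes> (z \<otimes> c))"
proof -
  have kk: "k \<in> cls k" by (rule cls_self[OF k(1)])
  obtain m where m: "cls k = {k, m}" "m \<noteq> k"
  proof -
    obtain p q where "cls k = {p, q}" "p \<noteq> q" using k(2) by (auto simp: card_2_iff)
    moreover from this kk have "k = p \<or> k = q" by simp
    ultimately show thesis using that by (metis insert_commute)
  qed
  interpret S: subgroup "{\<one>, k, m}" G
    using rstab_subgroup[OF cls_closed[OF x(1)]] unfolding stab m(1) .
  have mG: "m \<in> carrier G" using S.subset by blast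
  have kne: "k \<noteq> \<one>" and mne: "m \<noteq> \<one>" using k1 m(1) by blast+
  have km: "k \<otimes> m = \<one>"
  proof -
    have "k \<otimes> m \<in> {\<one>, k, m}" by (rule S.m_closed) auto
    then show ?thesis using kne mne k(1) mG by auto
  qed
  have mk: "m = inv k" using km k(1) mG by (metis inv_equality inv_inv inv_closed l_inv r_inv inv_unique')
  have sq: "k \<otimes> k = inv k"
  proof -
    have "k \<otimes> k \<in> {\<one>, k, m}" by (rule S.m_closed) auto
    moreover have "k \<otimes> k \<noteq> \<one>" using km k(1) mG m(2) by (metis l_cancel)
    ultimately show ?thesis using kne k(1) mk by auto
  qed
  have isq: "inv k \<otimes> inv k = k" using sq k(1) by (metis inv_inv inv_mult_group)
  have kik: "inv k \<noteq> k" using m(2) mk by simp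
  have ck: "cls k = {k, inv k}" using m(1) mk by simp
  have max: "card (cls g) \<le> 3" if "g \<in> carrier G" for g using sizes[OF that] by auto
  \<comment> \<open>The quotient of the members k^-1 and k of \<open>cls k\<close> is k^-2 = k, so S
    stabilizes every class of size three, not only that of \<open>x\<close>; such a class is a coset
    of S.\<close>
  have full: "cls u = {u, u \<otimes> k, u \<otimes> inv k}" if u: "u \<in> carrier G" "card (cls u) = 3" for u
  proof -
    have "coprime (card (cls u)) (card (cls k))" unfolding u k(2) by simp
    then have "inv k \<otimes> inv k \<in> rstab (cls u)"
      using max u by (intro mult_inv_in_rstab[OF u(1) k(1)]) (auto simp: ck)
    then have kS: "k \<in> rstab (cls u)" unfolding isq .
    have "u \<otimes> k \<in> cls u" by (rule rstabD(2)[OF kS cls_self[OF u(1)]])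
    moreover from rstabD(2)[OF kS this] have "u \<otimes> inv k \<in> cls u"
      using u(1) k(1) by (simp add: m_assoc sq)
    ultimately have "{u, u \<otimes> k, u \<otimes> inv k} \<subseteq> cls u" using cls_self[OF u(1)] by blast
    moreover have "card {u, u \<otimes> k, u \<otimes> inv k} = 3"
      using u(1) k(1) kne kik by (auto simp: card_insert_if)
    ultimately show ?thesis using card_subset_eq[OF finite_cls[OF u(1)]] u(2) by metis
  qed
  have small: "\<exists>z\<in>center G. \<exists>c\<in>{\<one>, k, inv k}. g = z \<otimes> c"
    if g: "g \<in> carrier G" "card (cls g) \<noteq> 3" for g
  proof (cases "card (cls g) = 1")
    case True
    then have "g \<in> center G" using card_cls_eq_1_iff[OF g(1)] by simp
    then show ?thesis using g(1) by (intro bexI[of _ g] bexI[of _ \<one>]) auto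
  next
    case False
    \<comment> \<open>The coset of \<open>g\<close> has three elements, so a class of size two
      leaves room for just one more, which is then central.\<close>
    then have g2: "card (cls g) = 2" using sizes[OF g(1)] g(2) by auto
    have c3: "card (rstab (cls x)) = 3" unfolding stab using k1 k(2) finite_cls[OF k(1)] by simp
    have "card (rstab (cls x) #> g) = 3" unfolding card_rcoset_rstab[OF x(1) g(1)] by (rule c3)
    then have "\<not> rstab (cls x) #> g \<subseteq> cls g"
      using card_mono[OF finite_cls[OF g(1)], of "rstab (cls x) #> g"] g2 by auto
    then obtain w where w: "w \<in> (rstab (cls x) #> g) - cls g" by blast
    have "w \<in> center G"
    proof (rule rcoset_remainder_central[OF x(1) g(1) _ _ _ w])
      show "coprime (card (cls x)) (card (cls g))" unfolding x(2) g2 by simp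
      show "card (cls h) \<le> card (cls x)" if "h \<in> carrier G" for h
        unfolding x(2) by (rule max[OF that])
      show "h \<in> center G" if h: "h \<in> carrier G" "card (cls h) + card (cls g) \<le> card (rstab (cls x))" for h
        using h(2) sizes[OF h(1)] card_cls_eq_1_iff[OF h(1)] unfolding c3 g2 by auto
    qed
    moreover obtain c where c: "c \<in> {\<one>, k, inv k}" "w = c \<otimes> g"
      using w unfolding r_coset_def stab ck by blast
    have cG: "c \<in> carrier G" using c(1) k(1) by auto
    have "g = w \<otimes> inv c"
      using center_commutes[OF \<open>w \<in> center G\<close>, of "inv c"] c(2) cG g(1)
      by (simp add: inv_cancel_left)
    moreover have "inv c \<in> {\<one>, k, inv k}" using c(1) k(1) by auto
    ultimately show ?thesis using \<open>w \<in> center G\<close> by metis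
  qed
  have inverts: "conj u k = inv k" if u: "u \<in> carrier G" "card (cls u) = 3" for u
  proof (rule ccontr)
    assume "conj u k \<noteq> inv k"
    moreover have "conj u k \<in> cls k" by (rule conj_in_cls[OF k(1) kk u(1)])
    ultimately have "conj u k = k" unfolding ck by blast
    then have uk: "u \<otimes> k = k \<otimes> u" using u(1) k(1) by (simp add: conj_eq_iff)
    have cop: "coprime (card (cls u)) (card (cls k))" unfolding u k(2) by simp
    \<comment> \<open>The sizes 3 and 2 are coprime, so some \<open>g\<close> moves \<open>u\<close>
      to \<open>u \<otimes> k\<close> while fixing \<open>k\<close>.\<close>
    have "u \<otimes> k \<in> cls u" unfolding full[OF u] by blast
    from simultaneous_conj[OF u(1) k(1) cop this kk]
    obtain g where g: "g \<in> carrier G" "conj g u = u \<otimes> k" "conj g k = k" by metis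
    have gk: "g \<otimes> k = k \<otimes> g" using g k(1) by (simp add: conj_eq_iff)
    have gu: "g \<otimes> u = u \<otimes> (g \<otimes> k)"
      using g u(1) k(1) gk by (simp add: conj_eq_iff m_assoc)
    \<comment> \<open>Conjugation by u^-1 permutes g, g k, g k^-1 cyclically, so \<open>g\<close>
      also has class size three and \<open>full\<close> applies to it.\<close>
    have iu: "conj (inv u) g = g \<otimes> k"
      using u(1) g(1) k(1) gu by (simp add: conj_def m_assoc inv_cancel_left)
    have "conj (inv u) k = k"
      using u(1) k(1) uk by (simp add: conj_def m_assoc inv_cancel_left flip: uk)
    then have iuk: "conj (inv u) (g \<otimes> k) = g \<otimes> inv k"
      using u(1) g(1) k(1) iu by (simp add: conj_mult m_assoc sq)
    have "g \<otimes> k \<in> cls g"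
      using conj_in_cls[OF g(1) cls_self[OF g(1)], of "inv u"] u(1) iu by simp
    moreover from conj_in_cls[OF g(1) this, of "inv u"] have "g \<otimes> inv k \<in> cls g"
      using u(1) iuk by simp
    ultimately have "{g, g \<otimes> k, g \<otimes> inv k} \<subseteq> cls g" using cls_self[OF g(1)] by blast
    then have "card {g, g \<otimes> k, g \<otimes> inv k} \<le> card (cls g)"
      by (rule card_mono[OF finite_cls[OF g(1)]])
    moreover have "card {g, g \<otimes> k, g \<otimes> inv k} = 3"
      using g(1) k(1) kne kik by (auto simp: card_insert_if)
    ultimately have g3: "card (cls g) = 3" using max[OF g(1)] by simp
    have "inv k \<in> cls k" unfolding ck by simp
    \<comment> \<open>Conjugation by \<open>t\<close> inverts \<open>k\<close> and changes
      \<open>g\<close> and \<open>u\<close> only by factors \<open>c\<close> and \<open>c'\<close>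
      from S, which commute with both.\<close>
    then obtain t where t: "t \<in> carrier G" "inv k = conj t k" unfolding cls_def by blast
    have "conj t g \<in> cls g" by (rule conj_in_cls[OF g(1) cls_self[OF g(1)] t(1)])
    then obtain c where c: "c \<in> {\<one>, k, inv k}" "conj t g = g \<otimes> c"
      unfolding full[OF g(1) g3] using g(1) r_one by (metis insert_iff singletonD)
    have "conj t u \<in> cls u" by (rule conj_in_cls[OF u(1) cls_self[OF u(1)] t(1)])
    then obtain c' where c': "c' \<in> {\<one>, k, inv k}" "conj t u = u \<otimes> c'"
      unfolding full[OF u] using u(1) r_one by (metis insert_iff singletonD)
    have G: "c \<in> carrier G" "c' \<in> carrier G" using c c' k(1) by auto
    have commute: "c \<otimes> v = v \<otimes> c"
      if "c \<in> {\<one>, k, inv k}" and v: "v \<in> carrier G" "v \<otimes> k = k \<otimes> v" for c v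
    proof -
      have "v = inv k \<otimes> v \<otimes> k" using v k(1) by (simp add: m_assoc inv_cancel_left)
      then have "inv k \<otimes> v = v \<otimes> inv k" using v(1) k(1) by (subst inv_solve_right) simp_all
      then show ?thesis using that k(1) by auto
    qed
    \<comment> \<open>Conjugating g u = u g k by \<open>t\<close> and cancelling the factors
      \<open>c\<close> and \<open>c'\<close> leaves k = k^-1.\<close>
    have "conj t (g \<otimes> u) = conj t (u \<otimes> (g \<otimes> k))" using gu by simp
    then have "g \<otimes> c \<otimes> (u \<otimes> c') = u \<otimes> c' \<otimes> (g \<otimes> c \<otimes> inv k)"
      using t(1) t(2)[symmetric] g(1) u(1) k(1) c(2) c'(2) by (simp add: conj_mult)
    moreover have "g \<otimes> c \<otimes> (u \<otimes> c') = u \<otimes> (g \<otimes> (k \<otimes> (c \<otimes> c')))"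
    proof -
      have "g \<otimes> c \<otimes> (u \<otimes> c') = g \<otimes> (c \<otimes> u) \<otimes> c'" using g(1) u(1) G by (simp add: m_assoc)
      also have "\<dots> = (g \<otimes> u) \<otimes> (c \<otimes> c')"
        unfolding commute[OF c(1) u(1) uk] using g(1) u(1) G by (simp add: m_assoc)
      finally show ?thesis unfolding gu using g(1) u(1) k(1) G by (simp add: m_assoc)
    qed
    moreover have "u \<otimes> c' \<otimes> (g \<otimes> c \<otimes> inv k) = u \<otimes> (g \<otimes> (c' \<otimes> (c \<otimes> inv k)))"
    proof -
      have "u \<otimes> c' \<otimes> (g \<otimes> c \<otimes> inv k) = u \<otimes> (c' \<otimes> g) \<otimes> (c \<otimes> inv k)"
        using g(1) u(1) k(1) G by (simp add: m_assoc)
      then show ?thesis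
        unfolding commute[OF c'(1) g(1) gk] using g(1) u(1) k(1) G by (simp add: m_assoc)
    qed
    ultimately have "k \<otimes> (c \<otimes> c') = c' \<otimes> (c \<otimes> inv k)"
      using g(1) u(1) k(1) G by simp
    then show False
      using c(1) c'(1) k(1) kne kik sq isq by (auto simp: inv_cancel_left)
  qed
  have xk: "conj x k = inv k" by (rule inverts[OF x])
  have xik: "conj x (inv k) = k" using xk x(1) k(1) by (simp add: conj_inv)
  \<comment> \<open>Elements of class size three invert \<open>k\<close>, so every element
    centralizing \<open>k\<close> is covered by \<open>small\<close>.\<close>
  have central: "\<exists>z\<in>center G. \<exists>c\<in>{\<one>, k, inv k}. g = z \<otimes> c"
    if "g \<in> carrier G" "conj g k = k" for g
    using that inverts[of g] kik by (intro small) auto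
  have "x \<otimes> x \<in> center G"
  proof -
    have "conj (x \<otimes> x) k = k" using x(1) k(1) xk xik by (simp flip: conj_conj)
    then obtain z c where zc: "z \<in> center G" "c \<in> {\<one>, k, inv k}" "x \<otimes> x = z \<otimes> c"
      using central[of "x \<otimes> x"] x(1) by auto
    have zG: "z \<in> carrier G" by (rule center_closed[OF zc(1)])
    have cG: "c \<in> carrier G" using zc(2) k(1) by auto
    \<comment> \<open>The square of \<open>x\<close> commutes with \<open>x\<close>, but
      \<open>x\<close> inverts its S-part \<open>c\<close>; hence \<open>c\<close> is
      trivial.\<close>
    have "conj x (z \<otimes> c) = z \<otimes> c" unfolding zc(3)[symmetric] using x(1) by (simp add: conj_eq_iff m_assoc)
    then have "z \<otimes> conj x c = z \<otimes> c"
      using x(1) zG cG conj_commute[OF zc(1) x(1)] by (simp add: conj_mult)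
    then have "conj x c = c" using x(1) zG cG by simp
    then have "c = \<one>" using zc(2) xk xik kik by auto
    then show ?thesis using zc zG by simp
  qed
  moreover have "\<exists>z\<in>center G. \<exists>c\<in>{\<one>, k, inv k}. g = z \<otimes> c \<or> g = x \<otimes> (z \<otimes> c)"
    if g: "g \<in> carrier G" for g
  proof (cases "card (cls g) = 3")
    case False
    then show ?thesis using small[OF g] by blast
  next
    case True
    \<comment> \<open>Both \<open>x\<close> and \<open>g\<close> invert \<open>k\<close>, so x^-1 g
      centralizes it.\<close>
    have "conj (inv x) (inv k) = k" using xk x(1) k(1) by (metis conj_inv_conj(1))
    then have "conj (inv x \<otimes> g) k = k"
      using inverts[OF g True] x(1) k(1) g by (simp flip: conj_conj)
    then obtain z c where zc: "z \<in> center G" "c \<in> {\<one>, k, inv k}" "inv x \<otimes> g = z \<otimes> c"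
      using central[of "inv x \<otimes> g"] x(1) g by auto
    then have "g = x \<otimes> (z \<otimes> c)" using x(1) g by (metis inv_cancel_left(2))
    then show ?thesis using zc by blast
  qed
  ultimately show ?thesis using kne sq xk by blast
qed

end

section \<open>Splitting a finite abelian group over a subgroup of index two\<close>

lemma (in subgroup) nat_pow_mem:
  assumes "x \<in> H" shows "x [^] (n::nat) \<in> H"
  using assms by (induction n) simp_all

context comm_group
begin

text \<open>In a finite abelian 2-group a cyclic subgroup whose order is the exponent splits off.
  The hypotheses \<open>exp\<close> and \<open>ord\<close> say that \<open>h\<close> has order 2^e,
  the exponent of \<open>L\<close>.\<close>

lemma complement_of_max_order:
  fixes e :: nat
  assumes fin: "finite (carrier G)" and L: "subgroup L G" and h: "h \<in> L"
    and exp: "\<And>x. x \<in> L \<Longrightarrow> x [^] (2 ^ e :: nat) = \<one>"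
    and ord: "\<And>i :: nat. h [^] i = \<one> \<Longrightarrow> 2 ^ e dvd i"
  obtains D where "subgroup D G" "D \<subseteq> L" "\<And>i :: nat. h [^] i \<in> D \<Longrightarrow> 2 ^ e dvd i"
    "\<And>x. x \<in> L \<Longrightarrow> \<exists>i :: nat. \<exists>c\<in>D. x = h [^] i \<otimes> c"
proof -
  interpret finite_group G by unfold_locales (rule fin)
  interpret L: subgroup L G by (rule L)
  have hG: "h \<in> carrier G" using h by (rule L.mem_carrier)
  \<comment> \<open>The candidates are the subgroups of \<open>L\<close> meeting the cyclic group of
    \<open>h\<close> trivially; a maximal one is the complement.\<close>
  define \<P> where "\<P> = {D. subgroup D G \<and> D \<subseteq> L \<and> (\<forall>i :: nat. h [^] i \<in> D \<longrightarrow> 2 ^ e dvd i)}"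
  have "{\<one>} \<in> \<P>" unfolding \<P>_def using ord L.one_closed triv_subgroup by blast
  moreover have "finite \<P>"
  proof (rule finite_subset)
    show "\<P> \<subseteq> Pow (carrier G)" unfolding \<P>_def using L.subset by blast
  qed (use fin in simp)
  ultimately obtain D where D: "D \<in> \<P>" and maxD: "\<And>E. E \<in> \<P> \<Longrightarrow> D \<subseteq> E \<Longrightarrow> D = E"
    using finite_has_maximal2[of \<P> "{\<one>}"] by metis
  have sD: "subgroup D G" and DL: "D \<subseteq> L" and Dh: "\<And>i :: nat. h [^] i \<in> D \<Longrightarrow> 2 ^ e dvd i"
    using D unfolding \<P>_def by blast+
  interpret D: subgroup D G by (rule sD)
  define T where "T = {h [^] i \<otimes> c | (i :: nat) c. c \<in> D}"
  have DT: "D \<subseteq> T"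
  proof
    fix c assume "c \<in> D"
    then have "c = h [^] (0::nat) \<otimes> c" by simp
    then show "c \<in> T" unfolding T_def using \<open>c \<in> D\<close> by blast
  qed
  have hT: "h [^] i \<otimes> t \<in> T" if t: "t \<in> T" for t and i :: nat
  proof -
    obtain j c where t': "t = h [^] (j::nat) \<otimes> c" "c \<in> D" using t unfolding T_def by blast
    then have "h [^] i \<otimes> t = h [^] (i + j) \<otimes> c" using hG by (simp add: m_assoc flip: nat_pow_mult)
    then show ?thesis unfolding T_def using t'(2) by blast
  qed
  have "L \<subseteq> T"
  proof
    fix x assume x: "x \<in> L"
    have oneT: "\<one> \<in> T" using DT D.one_closed by blast
    \<comment> \<open>Repeated squaring carries \<open>x\<close> into \<open>T\<close>, since its
      2^e-th power is the identity. If \<open>x\<close> is outside \<open>T\<close>, the power just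
      before that is \<open>y\<close> below, and its square lies in \<open>T\<close>.\<close>
    define n where "n = (LEAST n. x [^] (2 ^ n :: nat) \<in> T)"
    have n: "x [^] (2 ^ n :: nat) \<in> T"
      unfolding n_def by (rule LeastI[of _ e]) (simp add: exp[OF x] oneT)
    show "x \<in> T"
    proof (cases n)
      case 0
      then show ?thesis using n x by simp
    next
      case (Suc n')
      define y where "y = x [^] (2 ^ n' :: nat)"
      have xG: "x \<in> carrier G" using x by simp
      have yL: "y \<in> L" unfolding y_def by (rule L.nat_pow_mem[OF x])
      then have yG: "y \<in> carrier G" by simp
      have yT: "y \<notin> T"
        unfolding y_def using not_less_Least[of n' "\<lambda>n. x [^] (2 ^ n :: nat) \<in> T"] Suc n_def by simp
      have "y \<otimes> y = x [^] (2 ^ n :: nat)"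
        unfolding y_def Suc using nat_pow_mult[OF xG, of "2 ^ n'" "2 ^ n'"] by (simp add: mult_2)
      then obtain i c where c: "y \<otimes> y = h [^] (i::nat) \<otimes> c" "c \<in> D"
        using n unfolding T_def by auto
      have cG: "c \<in> carrier G" using c(2) by simp
      have "e \<noteq> 0"
      proof
        assume "e = 0"
        then have "x = \<one>" using exp[OF x] xG by simp
        then show False using yT oneT unfolding y_def by simp
      qed
      then obtain e' where e: "e = Suc e'" by (cases e) auto
      \<comment> \<open>Raising y y = h^i c to the power 2^(e-1) gives the identity, so h^(i
        2^(e-1)) lies in \<open>D\<close>; its exponent is a multiple of 2^e, hence i is
        even.\<close>
      have "\<one> = y [^] (2 * 2 ^ e' :: nat)" using exp[OF yL] unfolding e by simp
      also have "\<dots> = (y [^] (2::nat)) [^] (2 ^ e' :: nat)" using yG by (simp add: nat_pow_pow)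
      also have "y [^] (2::nat) = h [^] i \<otimes> c" using c(1) yG by (simp add: numeral_2_eq_2)
      also have "(h [^] i \<otimes> c) [^] (2 ^ e' :: nat) = h [^] (i * 2 ^ e') \<otimes> c [^] (2 ^ e' :: nat)"
        using hG cG by (simp add: nat_pow_distrib nat_pow_pow)
      finally have "h [^] (i * 2 ^ e') = inv (c [^] (2 ^ e' :: nat))"
        using hG cG by (metis inv_equality nat_pow_closed)
      also have "\<dots> \<in> D" by (intro D.m_inv_closed D.nat_pow_mem c(2))
      finally have "2 ^ e dvd i * 2 ^ e'" by (rule Dh)
      then have "even i" unfolding e by simp
      then obtain j where j: "i = j + j" by (auto elim!: evenE simp: mult_2)
      \<comment> \<open>Dividing \<open>y\<close> by h^j with i = 2 j removes the h-part of its
        square, so the square of \<open>q\<close> lies in \<open>D\<close> while \<open>q\<close>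
        stays outside \<open>T\<close>.\<close>
      define q where "q = inv (h [^] j) \<otimes> y"
      have qL: "q \<in> L"
        unfolding q_def by (intro L.m_closed L.m_inv_closed L.nat_pow_mem h yL)
      then have qG: "q \<in> carrier G" by simp
      have yq: "y = h [^] j \<otimes> q" unfolding q_def using hG yG by (simp add: inv_cancel_left)
      have qT: "q \<notin> T" using hT[of q j] yT unfolding yq by blast
      have qq: "q \<otimes> q = c"
      proof -
        have "h [^] j \<otimes> (h [^] j \<otimes> (q \<otimes> q)) = h [^] j \<otimes> (h [^] j \<otimes> c)"
          using c(1) hG qG cG unfolding yq j by (simp add: m_ac flip: nat_pow_mult)
        then show ?thesis using hG qG cG by simp
      qed
      \<comment> \<open>The square of \<open>q\<close> is in \<open>D\<close>, so \<open>E\<close>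
        is a subgroup. It still meets the powers of \<open>h\<close> trivially, because h^i = q d
        would put \<open>q\<close> into \<open>T\<close>; this contradicts maximality of
        \<open>D\<close>.\<close>
      define E where "E = D \<union> (\<lambda>d. q \<otimes> d) ` D"
      have qE: "q \<in> E" 
      proof -
        have "q = q \<otimes> \<one>" using qG by simp
        then show ?thesis unfolding E_def using D.one_closed by blast
      qed
      have "subgroup E G"
      proof (rule finite_closed_subgroup)
        show "E \<subseteq> carrier G" unfolding E_def using qG by auto
        show "\<one> \<in> E" unfolding E_def by simp
        have 1: "q \<otimes> d \<otimes> (q \<otimes> d') \<in> E" if "d \<in> D" "d' \<in> D" for d d'
        proof -
          have "q \<otimes> d \<otimes> (q \<otimes> d') = q \<otimes> q \<otimes> (d \<otimes> d')" using that qG by (simp add: m_ac)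
          then show ?thesis unfolding qq E_def using that c(2) by simp
        qed
        have 2: "q \<otimes> d \<otimes> d' \<in> E" "d' \<otimes> (q \<otimes> d) \<in> E" if "d \<in> D" "d' \<in> D" for d d'
        proof -
          have "q \<otimes> d \<otimes> d' = q \<otimes> (d \<otimes> d')" "d' \<otimes> (q \<otimes> d) = q \<otimes> (d \<otimes> d')"
            using that qG by (simp_all add: m_ac)
          then show "q \<otimes> d \<otimes> d' \<in> E" "d' \<otimes> (q \<otimes> d) \<in> E" unfolding E_def using that by simp_all
        qed
        have 3: "d \<otimes> d' \<in> E" if "d \<in> D" "d' \<in> D" for d d'
          unfolding E_def using that by simp
        show "u \<otimes> v \<in> E" if uv: "u \<in> E" "v \<in> E" for u v
        proof -
          have "u \<in> D \<or> (\<exists>d\<in>D. u = q \<otimes> d)" "v \<in> D \<or> (\<exists>d\<in>D. v = q \<otimes> d)"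
            using uv unfolding E_def by blast+
          then show ?thesis using 1 2 3 by (elim disjE bexE) simp_all
        qed
      qed
      moreover have "E \<subseteq> L" unfolding E_def using DL qL by blast
      moreover have "2 ^ e dvd i" if i: "h [^] i \<in> E" for i :: nat
      proof (rule Dh, rule ccontr)
        assume "h [^] i \<notin> D"
        then obtain d where d: "d \<in> D" "h [^] i = q \<otimes> d" using i unfolding E_def by blast
        then have "q = h [^] i \<otimes> inv d" using qG hG by (simp add: m_assoc)
        then show False using qT d(1) unfolding T_def by blast
      qed
      ultimately have "E \<in> \<P>" unfolding \<P>_def by blast
      then have "D = E" by (rule maxD) (simp add: E_def)
      then show ?thesis using qE qT DT by blast
    qed
  qed
  then show thesis using that[OF sD DL Dh] unfolding T_def by blast
qed


text \<open>If \<open>H = \<langle>h\<rangle> \<times> D\<close> with \<open>h\<close> of maximal order and neither factor lies in \<open>Z\<close>, then a generator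
  \<open>a \<in> D - Z\<close> found by induction corrects \<open>h\<close> to \<open>h \<otimes> a \<in> Z\<close>, which has the same order.\<close>
lemma two_group_index_two_split:
  fixes m :: nat
  assumes fin: "finite (carrier G)" and Z: "subgroup Z G"
    and index: "\<And>x y. x \<in> carrier G \<Longrightarrow> y \<in> carrier G \<Longrightarrow> x \<notin> Z \<Longrightarrow> y \<notin> Z \<Longrightarrow> x \<otimes> y \<in> Z"
  shows "subgroup L G \<Longrightarrow> (\<And>x. x \<in> L \<Longrightarrow> x [^] (2 ^ m :: nat) = \<one>) \<Longrightarrow> \<not> L \<subseteq> Z \<Longrightarrow>
    \<exists>a n C. a \<in> L - Z \<and> subgroup C G \<and> C \<subseteq> L \<inter> Z \<and> a [^] (2 ^ n :: nat) = \<one> \<and>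
      (\<forall>i :: nat. a [^] i \<in> C \<longrightarrow> 2 ^ n dvd i) \<and> (\<forall>x\<in>L. \<exists>i :: nat. \<exists>c\<in>C. x = a [^] i \<otimes> c)"
proof (induction "card L" arbitrary: L rule: less_induct)
  case less
  interpret finite_group G by unfold_locales (rule fin)
  interpret Z: subgroup Z G by (rule Z)
  interpret L: subgroup L G by (rule less.prems(1))
  \<comment> \<open>2^e is the exponent of \<open>L\<close>; minimality of \<open>e\<close> provides
    an element \<open>h\<close> of exactly this order.\<close>
  define e where "e = (LEAST e. \<forall>x\<in>L. x [^] (2 ^ e :: nat) = \<one>)"
  have exp: "\<forall>x\<in>L. x [^] (2 ^ e :: nat) = \<one>"
    unfolding e_def by (rule LeastI[of _ m]) (use less.prems(2) in blast)
  have "e \<noteq> 0"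
  proof
    assume "e = 0"
    then have "x = \<one>" if "x \<in> L" for x using that exp by force
    then show False using less.prems(3) Z.one_closed by blast
  qed
  then obtain e' where e: "e = Suc e'" by (cases e) auto
  then have "\<not> (\<forall>x\<in>L. x [^] (2 ^ e' :: nat) = \<one>)"
    unfolding e_def using not_less_Least[of e' "\<lambda>e. \<forall>x\<in>L. x [^] (2 ^ e :: nat) = \<one>"] by simp
  then obtain h where h: "h \<in> L" "h [^] (2 ^ e' :: nat) \<noteq> \<one>" by blast
  have hG: "h \<in> carrier G" using h(1) by simp
  have ord: "2 ^ e dvd i" if "h [^] i = \<one>" for i :: nat
  proof -
    have "ord h dvd 2 ^ e" using exp h(1) hG by (simp add: pow_eq_id)
    then obtain j where j: "j \<le> e" "ord h = 2 ^ j" using divides_primepow_nat[of 2] by auto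
    have "\<not> ord h dvd 2 ^ e'" using h(2) hG by (simp add: pow_eq_id)
    then have "\<not> j \<le> e'" using j(2) le_imp_power_dvd by metis
    then have "j = e" using j(1) e by simp
    then show ?thesis using that hG j(2) by (simp add: pow_eq_id)
  qed
  obtain D where D: "subgroup D G" "D \<subseteq> L" "\<And>i :: nat. h [^] i \<in> D \<Longrightarrow> 2 ^ e dvd i"
    "\<And>x. x \<in> L \<Longrightarrow> \<exists>i :: nat. \<exists>c\<in>D. x = h [^] i \<otimes> c"
    using complement_of_max_order[OF fin less.prems(1) h(1) _ ord] exp by blast
  interpret D: subgroup D G by (rule D(1))
  show ?case
  proof (cases "D \<subseteq> Z")
    case True
    have "h \<notin> Z"
    proof
      assume hZ: "h \<in> Z"
      have "x \<in> Z" if x: "x \<in> L" for x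
      proof -
        obtain i c where "c \<in> D" "x = h [^] (i::nat) \<otimes> c" using D(4)[OF x] by blast
        then show ?thesis using Z.nat_pow_mem[OF hZ] True by auto
      qed
      then show False using less.prems(3) by blast
    qed
    then have "h \<in> L - Z" "D \<subseteq> L \<inter> Z" using h(1) D(2) True by blast+
    moreover have "h [^] (2 ^ e :: nat) = \<one>" using exp h(1) by blast
    ultimately show ?thesis using D by blast
  next
    case False
    have "h \<notin> D"
    proof
      assume "h \<in> D"
      then have "2 ^ e dvd (1::nat)" using hG by (intro D(3)) simp
      then show False using \<open>e \<noteq> 0\<close> by simp
    qed
    then have "card D < card L"
      using D(2) h(1) L.subset fin by (intro psubset_card_mono) (auto intro: finite_subset)
    from less.hyps[OF this D(1) less.prems(2) False] D(2)
    obtain a n C where a: "a \<in> D - Z" "subgroup C G" "C \<subseteq> D \<inter> Z" "a [^] (2 ^ n :: nat) = \<one>"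
      and a': "\<forall>i :: nat. a [^] i \<in> C \<longrightarrow> 2 ^ n dvd i" "\<forall>x\<in>D. \<exists>i :: nat. \<exists>c\<in>C. x = a [^] i \<otimes> c"
      by blast
    note a = a a'(1)[rule_format] a'(2)[rule_format]
    interpret C: subgroup C G by (rule a(2))
    have aG: "a \<in> carrier G" using a(1) by simp
    \<comment> \<open>The exponent is 0 if \<open>h\<close> is already in \<open>Z\<close> and 1
      otherwise, so both cases are treated at once.\<close>
    obtain t where t: "h \<otimes> a [^] (t::nat) \<in> Z"
    proof (cases "h \<in> Z")
      case True
      then show ?thesis using that[of 0] hG by simp
    next
      case False
      then show ?thesis using that[of 1] index[OF hG aG] a(1) aG by simp
    qed
    define q where "q = h \<otimes> a [^] t"
    have atD: "a [^] i \<in> D" for i :: nat using a(1) by (intro D.nat_pow_mem) simp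
    have qL: "q \<in> L" unfolding q_def using h(1) atD D(2) by blast
    have qZ: "q \<in> Z" unfolding q_def by (rule t)
    have qG: "q \<in> carrier G" using qZ by simp
    have qpow: "q [^] i = h [^] i \<otimes> a [^] (t * i)" for i :: nat
      unfolding q_def using hG aG by (simp add: nat_pow_distrib nat_pow_pow)
    define E where "E = {q [^] i \<otimes> c | (i :: nat) c. c \<in> C}"
    have "subgroup E G"
    proof (rule finite_closed_subgroup)
      show "E \<subseteq> carrier G" unfolding E_def using qG by auto
      have "\<one> = q [^] (0::nat) \<otimes> \<one>" by simp
      then show "\<one> \<in> E" unfolding E_def using C.one_closed by blast
      show "u \<otimes> v \<in> E" if uv: "u \<in> E" "v \<in> E" for u v
      proof -
        obtain i c j d where u: "u = q [^] (i::nat) \<otimes> c" "c \<in> C" and v: "v = q [^] (j::nat) \<otimes> d" "d \<in> C"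
          using uv unfolding E_def by blast
        have "u \<otimes> v = q [^] (i + j) \<otimes> (c \<otimes> d)"
          unfolding u v using qG u(2) v(2) by (simp add: m_ac flip: nat_pow_mult)
        then show ?thesis unfolding E_def using u(2) v(2) by blast
      qed
    qed
    moreover have "E \<subseteq> L \<inter> Z"
    proof
      fix v assume "v \<in> E"
      then obtain i c where v: "v = q [^] (i::nat) \<otimes> c" "c \<in> C" unfolding E_def by blast
      have "c \<in> L" "c \<in> Z" using v(2) a(3) D(2) by blast+
      then show "v \<in> L \<inter> Z"
        unfolding v using L.nat_pow_mem[OF qL] Z.nat_pow_mem[OF qZ] by simp
    qed
    \<comment> \<open>Modulo \<open>D\<close> only the factor h^j of q^j survives, so h^j lies in
      \<open>D\<close> and 2^e divides j. Then q^j is trivial and a^i lies in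
      \<open>C\<close>.\<close>
    moreover have "2 ^ n dvd i" if i: "a [^] i \<in> E" for i :: nat
    proof -
      obtain j c where j: "a [^] i = q [^] (j::nat) \<otimes> c" "c \<in> C" using i unfolding E_def by blast
      have cD: "c \<in> D" using j(2) a(3) by blast
      have cG: "c \<in> carrier G" using cD by simp
      have "h [^] j \<otimes> (a [^] (t * j) \<otimes> c) = a [^] i"
        unfolding j(1) qpow using hG aG cG by (simp add: m_assoc)
      then have "h [^] j = a [^] i \<otimes> inv (a [^] (t * j) \<otimes> c)"
        using hG aG cG by (metis inv_solve_right' m_closed nat_pow_closed)
      also have "\<dots> \<in> D" by (intro D.m_closed D.m_inv_closed atD cD)
      finally have "2 ^ e dvd j" by (rule D(3))
      then obtain l where l: "j = 2 ^ e * l" by (elim dvdE)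
      have "q [^] j = \<one>"
        unfolding l using exp qL qG by (simp add: nat_pow_pow[symmetric])
      then have "a [^] i \<in> C" using j cG by simp
      then show ?thesis by (rule a(5))
    qed
    moreover have "\<exists>i :: nat. \<exists>c\<in>E. x = a [^] i \<otimes> c" if x: "x \<in> L" for x
    proof -
      obtain i d where d: "d \<in> D" "x = h [^] (i::nat) \<otimes> d" using D(4)[OF x] by blast
      obtain j c where c: "c \<in> C" "d = a [^] (j::nat) \<otimes> c" using a(6)[OF d(1)] by blast
      have cG: "c \<in> carrier G" using c(1) by simp
      \<comment> \<open>Replacing \<open>h\<close> by q a^-t requires the inverse of a^(t i); as
        a^(2^n) = 1 it is the natural power with exponent t i (2^n - 1).\<close>
      have at: "a [^] (t * i * (2 ^ n - 1)) \<otimes> a [^] (t * i) = \<one>"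
      proof -
        have "t * i * (2 ^ n - 1) + t * i = 2 ^ n * (t * i)"
          by (cases "2 ^ n :: nat") (simp_all add: algebra_simps)
        then have "a [^] (t * i * (2 ^ n - 1)) \<otimes> a [^] (t * i) = a [^] (2 ^ n * (t * i))"
          by (simp only: nat_pow_mult[OF aG])
        also have "\<dots> = (a [^] (2 ^ n :: nat)) [^] (t * i)" by (rule nat_pow_pow[OF aG, symmetric])
        finally show ?thesis using a(4) by simp
      qed
      have "a [^] (t * i * (2 ^ n - 1) + j) \<otimes> (q [^] i \<otimes> c)
          = (a [^] (t * i * (2 ^ n - 1)) \<otimes> a [^] (t * i)) \<otimes> (h [^] i \<otimes> (a [^] j \<otimes> c))"
        unfolding qpow using hG aG cG by (simp add: m_ac flip: nat_pow_mult)
      then have "x = a [^] (t * i * (2 ^ n - 1) + j) \<otimes> (q [^] i \<otimes> c)"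
        unfolding at d(2) c(2) using hG aG cG by simp
      then show ?thesis unfolding E_def using c(1) by blast
    qed
    moreover have "a \<in> L - Z" using a(1) D(2) by blast
    ultimately show ?thesis using a(4) by blast
  qed
qed

text \<open>An element of odd order is a power of its square, and squares lie in \<open>Z\<close>.
  So the odd part of the group lies in \<open>Z\<close> and can be added to the complement found in
  the 2-part.\<close>

lemma index_two_split:
  assumes fin: "finite (carrier G)" and Z: "subgroup Z G" and ne: "\<not> carrier G \<subseteq> Z"
    and index: "\<And>x y. x \<in> carrier G \<Longrightarrow> y \<in> carrier G \<Longrightarrow> x \<notin> Z \<Longrightarrow> y \<notin> Z \<Longrightarrow> x \<otimes> y \<in> Z"
  obtains a C and n :: nat where "a \<in> carrier G" "a \<notin> Z" "subgroup C G" "C \<subseteq> Z"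
    "a [^] (2 ^ n :: nat) = \<one>" "\<And>i :: nat. a [^] i \<in> C \<Longrightarrow> 2 ^ n dvd i"
    "\<And>x. x \<in> carrier G \<Longrightarrow> \<exists>i :: nat. \<exists>c\<in>C. x = a [^] i \<otimes> c"
proof -
  interpret finite_group G by unfold_locales (rule fin)
  interpret Z: subgroup Z G by (rule Z)
  have "order G > 0" using fin by (auto simp: order_def card_gt_0_iff)
  then obtain k m :: nat where km: "order G = 2 ^ k * m" "odd m"
    using multiplicity_decompose'[of "order G" "2::nat"] by (metis nat_neq_iff prime_elem_not_unit prime_imp_prime_elem two_is_prime_nat)
  define L where "L = {x \<in> carrier G. x [^] (2 ^ k :: nat) = \<one>}"
  define Q where "Q = {x \<in> carrier G. x [^] m = \<one>}"
  have sL: "subgroup L G" and sQ: "subgroup Q G"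
    unfolding L_def Q_def by (rule finite_closed_subgroup; simp add: nat_pow_distrib)+
  interpret L: subgroup L G by (rule sL)
  interpret Q: subgroup Q G by (rule sQ)
  \<comment> \<open>By Bezout x^(m p) is x times x^(2^k q), which separates \<open>x\<close> into a
    factor of 2-power order and one of odd order.\<close>
  obtain p q where pq: "m * p = 2 ^ k * q + 1"
  proof -
    have "gcd m (2 ^ k) = 1" using km(2) by (simp flip: coprime_iff_gcd_eq_1)
    moreover have "m \<noteq> 0" using km(2) by (intro notI) simp
    ultimately show thesis using bezout_nat[of m "2 ^ k"] that by metis
  qed
  have split: "\<exists>u\<in>L. \<exists>v\<in>Q. x = u \<otimes> v" if x: "x \<in> carrier G" for x
  proof -
    have one: "x [^] (2 ^ k * m) = \<one>" using pow_order_eq_1[OF x] km(1) by simp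
    have "(x [^] (m * p)) [^] (2 ^ k :: nat) = (x [^] (2 ^ k * m)) [^] p"
      using x by (simp add: nat_pow_pow mult_ac)
    then have u: "x [^] (m * p) \<in> L" unfolding L_def using x one by simp
    have "(x [^] (2 ^ k * q)) [^] m = (x [^] (2 ^ k * m)) [^] q"
      using x by (simp add: nat_pow_pow mult_ac)
    then have v: "x [^] (2 ^ k * q) \<in> Q" unfolding Q_def using x one by simp
    have "x [^] (m * p) = x [^] (2 ^ k * q) \<otimes> x" unfolding pq using x by simp
    then have "x = x [^] (m * p) \<otimes> inv (x [^] (2 ^ k * q))"
      using x by (metis inv_solve_right m_comm nat_pow_closed)
    then show ?thesis using u Q.m_inv_closed[OF v] by blast
  qed
  have LQ: "x = \<one>" if x: "x \<in> L" "x \<in> Q" for x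
  proof -
    have xG: "x \<in> carrier G" using x by simp
    have "x [^] (m * p) = x [^] (2 ^ k * q) \<otimes> x" unfolding pq using xG by simp
    then show ?thesis
      using x xG unfolding L_def Q_def by (simp add: nat_pow_pow[symmetric])
  qed
  have QZ: "Q \<subseteq> Z"
  proof
    fix x assume "x \<in> Q"
    then have x: "x \<in> carrier G" "x [^] m = \<one>" unfolding Q_def by blast+
    show "x \<in> Z"
    proof (rule ccontr)
      assume xZ: "x \<notin> Z"
      obtain j where j: "m = 2 * j + 1" using km(2) by (elim oddE)
      have "x [^] (2::nat) \<in> Z" using index[OF x(1) x(1) xZ xZ] x(1) by (simp add: numeral_2_eq_2)
      then have "(x [^] (2::nat)) [^] j \<in> Z" by (rule Z.nat_pow_mem)
      then have "x [^] (2 * j) \<in> Z" using x(1) by (simp add: nat_pow_pow)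
      moreover have "x [^] (2 * j) \<otimes> x = \<one>" using x unfolding j by simp
      then have "x = inv (x [^] (2 * j))" using x(1) by (metis inv_equality inv_inv nat_pow_closed)
      ultimately show False using xZ Z.m_inv_closed by metis
    qed
  qed
  have "\<not> L \<subseteq> Z"
  proof
    assume "L \<subseteq> Z"
    then have "carrier G \<subseteq> Z" using split QZ by (metis Z.m_closed subsetD subsetI)
    then show False using ne by blast
  qed
  moreover have "x [^] (2 ^ k :: nat) = \<one>" if "x \<in> L" for x using that unfolding L_def by blast
  ultimately obtain a n C where a: "a \<in> L" "a \<notin> Z" "subgroup C G" "C \<subseteq> L \<inter> Z" "a [^] (2 ^ n :: nat) = \<one>"
    and a': "\<forall>i :: nat. a [^] i \<in> C \<longrightarrow> 2 ^ n dvd i" "\<forall>x\<in>L. \<exists>i :: nat. \<exists>c\<in>C. x = a [^] i \<otimes> c"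
    using two_group_index_two_split[OF fin Z index sL, of k] by blast
  note a = a a'(1)[rule_format] a'(2)[rule_format]
  interpret C: subgroup C G by (rule a(3))
  show thesis
  proof (rule that)
    show "a \<in> carrier G" using a(1) by simp
    show "a \<notin> Z" "a [^] (2 ^ n :: nat) = \<one>" by (rule a)+
    show "subgroup (C <#> Q) G" by (rule mult_subgroups[OF a(3) sQ])
    show "C <#> Q \<subseteq> Z" unfolding set_mult_def using a(4) QZ by blast
    show "2 ^ n dvd i" if "a [^] i \<in> C <#> Q" for i :: nat
    proof -
      obtain c v where cv: "c \<in> C" "v \<in> Q" "a [^] i = c \<otimes> v"
        using \<open>a [^] i \<in> C <#> Q\<close> unfolding set_mult_def by blast
      have G: "c \<in> carrier G" "v \<in> carrier G" "a \<in> carrier G" using cv a(1) by simp_all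
      have "v = inv c \<otimes> a [^] i" unfolding cv(3) using G by (simp add: inv_cancel_left)
      also have "\<dots> \<in> L"
        using cv(1) a(4) by (intro L.m_closed L.m_inv_closed L.nat_pow_mem a(1)) blast
      finally have "v = \<one>" using cv(2) by (intro LQ)
      then show ?thesis using cv G by (intro a(6)) simp
    qed
    show "\<exists>i :: nat. \<exists>c\<in>C <#> Q. x = a [^] i \<otimes> c" if x: "x \<in> carrier G" for x
    proof -
      obtain u v where uv: "u \<in> L" "v \<in> Q" "x = u \<otimes> v" using split[OF x] by blast
      obtain i c where c: "c \<in> C" "u = a [^] (i::nat) \<otimes> c" using a(7)[OF uv(1)] by blast
      have "x = a [^] i \<otimes> (c \<otimes> v)" unfolding uv(3) c(2) using a(1) c(1) uv(2) by (simp add: m_assoc)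
      then show ?thesis unfolding set_mult_def using c(1) uv(2) by blast
    qed
  qed
qed

end

section \<open>The groups \<open>G\<^sub>n\<close> and \<open>S\<^sub>3\<close>\<close>

text \<open>A common setting for the group itself, G_n, S_3, and the products of G_n with abelian
  groups. Stating b^3 = 1 as b b = b^-1 lets products in {1, b, b^-1} be computed by
  rewriting.\<close>

locale inverting_pair = group +
  fixes a b
  assumes a_closed [simp]: "a \<in> carrier G" and b_closed [simp]: "b \<in> carrier G"
    and conj_a_b: "conj a b = inv b" and b_sq: "b \<otimes> b = inv b" and b_ne: "b \<noteq> \<one>"
begin

definition K where "K = {\<one>, b, inv b}"

lemma K_closed: "c \<in> K \<Longrightarrow> c \<in> carrier G"
  by (auto simp: K_def)

lemma inv_b_sq: "inv b \<otimes> inv b = b"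
  using b_sq by (metis b_closed inv_inv inv_mult_group)

lemma inv_b_ne: "inv b \<noteq> b" "inv b \<noteq> \<one>"
proof -
  show "inv b \<noteq> b" using b_ne b_sq b_closed by (metis l_cancel_one)
  show "inv b \<noteq> \<one>" using b_ne by (metis b_closed inv_inv inv_one)
qed

lemma K_mult: "c \<in> K \<Longrightarrow> d \<in> K \<Longrightarrow> c \<otimes> d \<in> K"
  by (auto simp: K_def b_sq inv_b_sq)

lemma K_inv: "c \<in> K \<Longrightarrow> inv c \<in> K"
  by (auto simp: K_def)

lemma K_commute: "c \<in> K \<Longrightarrow> d \<in> K \<Longrightarrow> c \<otimes> d = d \<otimes> c"
  by (auto simp: K_def)

lemma conj_a_inv_b: "conj a (inv b) = b"
  by (simp add: conj_inv conj_a_b)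

lemma conj_a_K: "c \<in> K \<Longrightarrow> conj a c = inv c"
  by (auto simp: K_def conj_a_b conj_a_inv_b)

lemma conj_a_fixed: "c \<in> K \<Longrightarrow> conj a c = c \<Longrightarrow> c = \<one>"
  using inv_b_ne by (auto simp: K_def conj_a_b conj_a_inv_b)

lemma a_notin_K: "a \<notin> K"
proof
  assume "a \<in> K"
  then have "conj a b = b" using K_commute[of a b] by (simp add: conj_eq_iff K_def)
  then show False using conj_a_b inv_b_ne by simp
qed

lemma card_K: "card K = 3"
  using b_ne b_ne[symmetric] inv_b_ne inv_b_ne[symmetric] by (simp add: K_def card_insert_if)

lemma K_mult_a: "c \<in> K \<Longrightarrow> c \<otimes> a = a \<otimes> inv c"
proof -
  assume c: "c \<in> K"
  have "a \<otimes> inv c = c \<otimes> a"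
    using conj_a_K[OF K_inv[OF c]] K_closed[OF c] by (simp add: conj_eq_iff)
  then show ?thesis by simp
qed

lemma K_mult_pow_a:
  assumes "c \<in> K" shows "\<exists>d\<in>K. c \<otimes> a [^] (i::nat) = a [^] i \<otimes> d"
proof (induction i)
  case 0
  then show ?case using assms K_closed by auto
next
  case (Suc i)
  then obtain d where d: "d \<in> K" "c \<otimes> a [^] i = a [^] i \<otimes> d" by blast
  have "c \<otimes> a [^] Suc i = (c \<otimes> a [^] i) \<otimes> a" using K_closed[OF assms] by (simp add: m_assoc)
  also have "\<dots> = a [^] i \<otimes> (d \<otimes> a)" unfolding d(2) using K_closed[OF d(1)] by (simp add: m_assoc)
  also have "\<dots> = a [^] Suc i \<otimes> inv d"
    unfolding K_mult_a[OF d(1)] using K_closed[OF d(1)] by (simp add: m_assoc)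
  finally show ?case using K_inv[OF d(1)] by blast
qed

lemma conj_pow_a_b:
  assumes sq: "a \<otimes> a \<in> center G"
  shows "conj (a [^] (i::nat)) b = (if even i then b else inv b)"
proof (induction i)
  case (Suc i)
  have "conj (a [^] Suc i) b = conj (a [^] i) (conj a b)" by (simp add: conj_conj)
  then show ?case using Suc by (simp add: conj_a_b conj_inv)
qed simp

text \<open>Commuting with \<open>a\<close> forces \<open>c\<close> to be trivial, since
  \<open>a\<close> inverts \<open>K\<close>; commuting with \<open>b\<close> then forces
  \<open>i\<close> to be even, since odd powers of \<open>a\<close> invert \<open>b\<close>. This
  criterion later yields the center, injectivity, and the kernel of the map onto S_3.\<close>

lemma pow_a_mult_K_central:
  assumes sq: "a \<otimes> a \<in> center G" and c: "c \<in> K" and central: "a [^] (i::nat) \<otimes> c \<in> center G"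
  shows "even i" "c = \<one>"
proof -
  have cG: "c \<in> carrier G" by (rule K_closed[OF c])
  have "a \<otimes> a [^] i = a [^] i \<otimes> a" by (metis a_closed nat_pow_Suc nat_pow_Suc2)
  then have "conj a (a [^] i) = a [^] i" by (simp add: conj_eq_iff)
  then have "a [^] i \<otimes> conj a c = a [^] i \<otimes> c"
    using conj_commute[OF central a_closed] cG by (simp add: conj_mult)
  then have "conj a c = c" using cG by simp
  then show c1: "c = \<one>" by (rule conj_a_fixed[OF c])
  have "a [^] i \<in> center G" using central c1 by simp
  then have "conj (a [^] i) b = b"
    using center_commutes[of "a [^] i" b] by (simp add: conj_eq_iff)
  then show "even i" using conj_pow_a_b[OF sq, of i] inv_b_ne by (auto split: if_splits)
qed

text \<open>Central factors of a conjugating element have no effect, so conjugating by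
  \<open>K\<close> and by its coset of \<open>a\<close> gives whole classes. Up to central factors
  every element is the identity, a conjugate of \<open>b\<close>, or a conjugate of
  \<open>a\<close>.\<close>

lemma cs_eq_123:
  assumes gen: "\<And>g. g \<in> carrier G \<Longrightarrow> \<exists>z\<in>center G. \<exists>c\<in>K. g = z \<otimes> c \<or> g = z \<otimes> (a \<otimes> c)"
  shows "cs G = {1, 2, 3}"
proof -
  have conj_K: "conj c d = d" if "c \<in> K" "d \<in> K" for c d
    using that K_commute[OF that] by (simp add: conj_eq_iff K_closed)
  \<comment> \<open>c a c^-1 = a c^-2 = a c, because c^3 = 1; so the class of \<open>a\<close> fills
    the coset a K.\<close>
  have conj_a: "conj c a = a \<otimes> c" if c: "c \<in> K" for c
  proof -
    have cG: "c \<in> carrier G" by (rule K_closed[OF c])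
    have "inv c = c \<otimes> c" using c b_sq inv_b_sq by (auto simp: K_def)
    then have "c \<otimes> a = a \<otimes> (c \<otimes> c)" using K_mult_a[OF c] by simp
    then show ?thesis using cG by (simp add: conj_eq_iff m_assoc)
  qed
  have conj_zc: "conj (z \<otimes> h) g = conj h g" if "z \<in> center G" "h \<in> carrier G" "g \<in> carrier G" for z h g
  proof -
    have "conj z (conj h g) = conj h g"
      using that center_closed[OF that(1)] center_commutes[OF that(1), of "conj h g"]
      by (simp add: conj_eq_iff)
    then show ?thesis using that center_closed[OF that(1)] by (simp add: conj_conj)
  qed
  have b: "cls b = {b, inv b}"
  proof
    show "cls b \<subseteq> {b, inv b}"
    proof
      fix y assume "y \<in> cls b"
      then obtain g where g: "g \<in> carrier G" "y = conj g b" unfolding cls_def by blast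
      obtain z c where zc: "z \<in> center G" "c \<in> K" "g = z \<otimes> c \<or> g = z \<otimes> (a \<otimes> c)"
        using gen[OF g(1)] by blast
      have "conj c b = b" using conj_K[OF zc(2)] by (simp add: K_def)
      then show "y \<in> {b, inv b}"
        using zc g(2) K_closed[OF zc(2)] by (auto simp: conj_zc conj_a_b simp flip: conj_conj)
    qed
    show "{b, inv b} \<subseteq> cls b"
      using cls_self[of b] conj_in_cls[OF _ cls_self, of b a] by (simp add: conj_a_b)
  qed
  have a: "cls a = (\<lambda>c. a \<otimes> c) ` K"
  proof
    show "cls a \<subseteq> (\<lambda>c. a \<otimes> c) ` K"
    proof
      fix y assume "y \<in> cls a"
      then obtain g where g: "g \<in> carrier G" "y = conj g a" unfolding cls_def by blast
      obtain z c where zc: "z \<in> center G" "c \<in> K" "g = z \<otimes> c \<or> g = z \<otimes> (a \<otimes> c)"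
        using gen[OF g(1)] by blast
      have cG: "c \<in> carrier G" by (rule K_closed[OF zc(2)])
      have aa: "conj a a = a" by (simp add: conj_eq_iff)
      have "conj c a = a \<otimes> c" by (rule conj_a[OF zc(2)])
      moreover from this have "conj (a \<otimes> c) a = a \<otimes> inv c"
        using cG aa conj_a_K[OF zc(2)] by (simp add: conj_mult flip: conj_conj)
      ultimately have "y = a \<otimes> c \<or> y = a \<otimes> inv c"
        using zc g(2) cG by (auto simp: conj_zc)
      then show "y \<in> (\<lambda>c. a \<otimes> c) ` K" using zc(2) K_inv[OF zc(2)] by blast
    qed
    show "(\<lambda>c. a \<otimes> c) ` K \<subseteq> cls a"
    proof
      fix y assume "y \<in> (\<lambda>c. a \<otimes> c) ` K"
      then obtain c where c: "c \<in> K" "y = a \<otimes> c" by blast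
      have "conj c a \<in> cls a" unfolding cls_def using K_closed[OF c(1)] by blast
      then show "y \<in> cls a" unfolding c(2) conj_a[OF c(1)] .
    qed
  qed
  have "card ((\<lambda>c. a \<otimes> c) ` K) = card K"
    by (rule card_image) (meson K_closed a_closed inj_onI l_cancel)
  then have card_a: "card (cls a) = 3" unfolding a card_K .
  have card_b: "card (cls b) = 2" unfolding b using inv_b_ne by (simp add: card_insert_if)
  have card_1: "card (cls \<one>) = 1" using cls_center[OF subgroup.one_closed[OF center_subgroup]] by simp
  have "card (cls g) \<in> {1, 2, 3}" if "g \<in> carrier G" for g
  proof -
    obtain z c where zc: "z \<in> center G" "c \<in> K" "g = z \<otimes> c \<or> g = z \<otimes> (a \<otimes> c)"
      using gen[OF \<open>g \<in> carrier G\<close>] by blast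
    have cG: "c \<in> carrier G" by (rule K_closed[OF zc(2)])
    from zc(3) show ?thesis
    proof
      assume "g = z \<otimes> c"
      then have "card (cls g) = card (cls c)" using card_cls_mult_center[OF zc(1) cG] by simp
      moreover have "c = \<one> \<or> c \<in> cls b" using zc(2) unfolding b K_def by blast
      ultimately show ?thesis using cls_eq[OF b_closed, of c] card_b card_1 by auto
    next
      assume "g = z \<otimes> (a \<otimes> c)"
      then have "card (cls g) = card (cls (a \<otimes> c))" using card_cls_mult_center[OF zc(1)] cG by simp
      moreover have "a \<otimes> c \<in> cls a" unfolding a using zc(2) by blast
      ultimately show ?thesis using cls_eq[OF a_closed, of "a \<otimes> c"] card_a by simp
    qed
  qed
  moreover have "1 \<in> (\<lambda>x. card (cls x)) ` carrier G"
    by (rule image_eqI[of _ _ \<one>]) (simp_all add: card_1)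
  moreover have "2 \<in> (\<lambda>x. card (cls x)) ` carrier G"
    by (rule image_eqI[of _ _ b]) (simp_all add: card_b)
  moreover have "3 \<in> (\<lambda>x. card (cls x)) ` carrier G"
    by (rule image_eqI[of _ _ a]) (simp_all add: card_a)
  ultimately show ?thesis unfolding cs_eq by blast
qed

end

section \<open>The presented group through its generators\<close>

definition Gn_b :: "nat \<Rightarrow> ab word set" where
  "Gn_b n = gen_elt (Gn_rels n) Gen_b"

lemma group_Gn: "group (Gn n)"
  unfolding Gn_def by (rule group_presented_group)

interpretation Gn: group "Gn n" for n
  by (rule group_Gn)

lemma Gn_a_closed [simp]: "Gn_a n \<in> carrier (Gn n)"
  and Gn_b_closed [simp]: "Gn_b n \<in> carrier (Gn n)"
  by (simp_all add: Gn_def Gn_a_def Gn_b_def word_class_in_carrier)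

lemma eval_word_replicate:
  assumes "group H" "f x \<in> carrier H"
  shows "eval_word H f (replicate k (x, True)) = f x [^]\<^bsub>H\<^esub> k"
proof -
  interpret H: group H by (rule assms(1))
  have "eval_word H f (replicate k (x, True)) = f x [^]\<^bsub>H\<^esub> k"
    by (induction k) (use assms(2) in \<open>simp_all only: replicate_0 replicate_Suc eval_word.simps H.nat_pow_0 H.nat_pow_Suc2 if_True\<close>)
  then show ?thesis .
qed

lemma pow_word_class:
  "word_class R [x] [^]\<^bsub>presented_group R\<^esub> (k::nat) = word_class R (replicate k x)"
proof (induction k)
  case 0
  then show ?case by (simp add: one_presented_group nat_pow_def)
next
  case (Suc k)
  interpret P: group "presented_group R" by (rule group_presented_group)
  show ?case
    by (simp add: Suc mult_presented_group replicate_append_same)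
qed

lemma inv_word_class:
  "inv\<^bsub>presented_group R\<^esub> (word_class R [(x, s)]) = word_class R [(x, \<not> s)]"
proof -
  interpret P: group "presented_group R" by (rule group_presented_group)
  have "word_eq R [(x, \<not> s), (x, s)] []" using word_eq.cancel[of R x "\<not> s"] by simp
  then have "word_class R [(x, \<not> s)] \<otimes>\<^bsub>presented_group R\<^esub> word_class R [(x, s)] = \<one>\<^bsub>presented_group R\<^esub>"
    by (simp add: mult_presented_group one_presented_group word_class_eq_iff)
  then show ?thesis by (intro P.inv_equality) (simp_all add: word_class_in_carrier)
qed

lemma Gn_a_pow: "Gn_a n [^]\<^bsub>Gn n\<^esub> (2 ^ n :: nat) = \<one>\<^bsub>Gn n\<^esub>"
proof -
  have "word_eq (Gn_rels n) (replicate (2 ^ n) (Gen_a, True)) []"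
    by (rule word_eq.relation) (simp add: Gn_rels_def)
  then show ?thesis
    by (simp add: Gn_def Gn_a_def pow_word_class one_presented_group word_class_eq_iff)
qed

lemma Gn_b_sq: "Gn_b n \<otimes>\<^bsub>Gn n\<^esub> Gn_b n = inv\<^bsub>Gn n\<^esub> Gn_b n"
proof -
  have "word_eq (Gn_rels n) (replicate 3 (Gen_b, True)) []"
    by (rule word_eq.relation) (simp add: Gn_rels_def)
  then have "Gn_b n [^]\<^bsub>Gn n\<^esub> (3::nat) = \<one>\<^bsub>Gn n\<^esub>"
    by (simp only: Gn_def Gn_b_def pow_word_class one_presented_group word_class_eq_iff)
  then have "(Gn_b n \<otimes>\<^bsub>Gn n\<^esub> Gn_b n) \<otimes>\<^bsub>Gn n\<^esub> Gn_b n = \<one>\<^bsub>Gn n\<^esub>"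
    by (simp add: numeral_3_eq_3)
  then show ?thesis by (metis Gn.inv_equality Gn.m_closed Gn_b_closed)
qed

text \<open>The presentation prescribes a^-1 b a, while \<open>conj\<close> uses a b a^-1; as
  \<open>b\<close> goes to its inverse, the two versions are equivalent.\<close>

lemma Gn_conj: "group.conj (Gn n) (Gn_a n) (Gn_b n) = inv\<^bsub>Gn n\<^esub> Gn_b n"
proof -
  let ?a = "Gn_a n" and ?b = "Gn_b n"
  have "word_eq (Gn_rels n) [(Gen_a, False), (Gen_b, True), (Gen_a, True)] [(Gen_b, False)]"
    by (rule word_eq.relation) (simp add: Gn_rels_def)
  then have "inv\<^bsub>Gn n\<^esub> ?a \<otimes>\<^bsub>Gn n\<^esub> ?b \<otimes>\<^bsub>Gn n\<^esub> ?a = inv\<^bsub>Gn n\<^esub> ?b"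
    by (simp add: Gn_def Gn_a_def Gn_b_def inv_word_class mult_presented_group word_class_eq_iff)
  then have *: "Gn.conj n (inv\<^bsub>Gn n\<^esub> ?a) ?b = inv\<^bsub>Gn n\<^esub> ?b" by (simp add: Gn.conj_def)
  have "Gn.conj n ?a (inv\<^bsub>Gn n\<^esub> ?b) = ?b"
    unfolding *[symmetric] by (rule Gn.conj_inv_conj(2)) simp_all
  then show ?thesis by (simp add: Gn.conj_inv) (metis Gn.conj_closed Gn.inv_inv Gn_a_closed Gn_b_closed)
qed

lemma Gn_hom:
  assumes "group H" and a: "a \<in> carrier H" and b: "b \<in> carrier H"
    and an: "a [^]\<^bsub>H\<^esub> (2 ^ n :: nat) = \<one>\<^bsub>H\<^esub>" and b3: "b \<otimes>\<^bsub>H\<^esub> b = inv\<^bsub>H\<^esub> b"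
    and ab: "group.conj H a b = inv\<^bsub>H\<^esub> b"
  obtains h where "h \<in> hom (Gn n) H" "h (Gn_a n) = a" "h (Gn_b n) = b"
proof -
  interpret H: group H by (rule assms(1))
  define f where "f = case_ab a b"
  have f: "range f \<subseteq> carrier H" using a b by (auto simp: f_def split: ab.split)
  have rel: "eval_word H f u = eval_word H f v" if uv: "(u, v) \<in> Gn_rels n" for u v
  proof -
    have "H.conj (inv\<^bsub>H\<^esub> a) b = inv\<^bsub>H\<^esub> b"
      using H.conj_inv_conj(1)[OF a, of "inv\<^bsub>H\<^esub> b"] H.conj_inv[OF a b] ab b by simp
    then have conj: "inv\<^bsub>H\<^esub> a \<otimes>\<^bsub>H\<^esub> (b \<otimes>\<^bsub>H\<^esub> a) = inv\<^bsub>H\<^esub> b"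
      using a b by (simp add: H.conj_def H.m_assoc)
    have 3: "b [^]\<^bsub>H\<^esub> (3::nat) = \<one>\<^bsub>H\<^esub>" using b b3 by (simp add: numeral_3_eq_3)
    from uv consider "u = replicate (2 ^ n) (Gen_a, True)" "v = []"
      | "u = replicate 3 (Gen_b, True)" "v = []"
      | "u = [(Gen_a, False), (Gen_b, True), (Gen_a, True)]" "v = [(Gen_b, False)]"
      unfolding Gn_rels_def by blast
    then show ?thesis
    proof cases
      case 1
      then show ?thesis using eval_word_replicate[OF H.group_axioms, of f Gen_a] a an by (simp add: f_def)
    next
      case 2
      then show ?thesis
        using eval_word_replicate[OF H.group_axioms, of f Gen_b 3] b 3 by (simp only: f_def ab.case eval_word.simps)
    next
      case 3
      then show ?thesis using a b conj by (simp add: f_def)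
    qed
  qed
  from H.presented_group_universal[OF f rel] obtain h
    where h: "h \<in> hom (presented_group (Gn_rels n)) H" "\<And>x. h (gen_elt (Gn_rels n) x) = f x"
    by blast
  show thesis
  proof (rule that)
    show "h \<in> hom (Gn n) H" unfolding Gn_def by (rule h)
    show "h (Gn_a n) = a" "h (Gn_b n) = b" using h(2) by (simp_all add: Gn_a_def Gn_b_def f_def)
  qed
qed

definition S3_a :: "nat \<Rightarrow> nat" where "S3_a = transpose 1 2"
text \<open>The 3-cycle 1 -> 2 -> 3 -> 1.\<close>

definition S3_b :: "nat \<Rightarrow> nat" where "S3_b = transpose 1 2 \<circ> transpose 2 3"

interpretation S3: inverting_pair "sym_group 3" S3_a S3_b
proof -
  interpret group "sym_group 3" by (rule sym_group_is_group)
  have a: "S3_a \<in> carrier (sym_group 3)"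
    unfolding sym_group_carrier S3_a_def by (rule permutes_swap_id) simp_all
  have b: "S3_b \<in> carrier (sym_group 3)"
    unfolding sym_group_carrier S3_b_def by (intro permutes_compose permutes_swap_id) simp_all
  have "S3_b \<circ> S3_b \<circ> S3_b = id" by (auto simp: fun_eq_iff S3_b_def transpose_def)
  then have sq: "S3_b \<otimes>\<^bsub>sym_group 3\<^esub> S3_b = inv\<^bsub>sym_group 3\<^esub> S3_b"
    using b m_closed[OF b b] by (intro inv_equality[symmetric]) (simp_all add: sym_group_mult sym_group_one)
  have "S3_a \<circ> S3_b = S3_b \<circ> S3_b \<circ> S3_a" by (auto simp: fun_eq_iff S3_a_def S3_b_def transpose_def)
  then have "conj S3_a S3_b = inv\<^bsub>sym_group 3\<^esub> S3_b"
    using a b m_closed[OF b b] unfolding sq[symmetric] by (subst conj_eq_iff) (simp_all add: sym_group_mult)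
  moreover have "S3_b 1 \<noteq> id 1" by (simp add: S3_b_def transpose_def)
  then have "S3_b \<noteq> \<one>\<^bsub>sym_group 3\<^esub>" unfolding sym_group_one by metis
  ultimately show "inverting_pair (sym_group 3) S3_a S3_b"
    using a b sq by unfold_locales
qed

lemma S3_a_sq: "S3_a \<otimes>\<^bsub>sym_group 3\<^esub> S3_a = \<one>\<^bsub>sym_group 3\<^esub>"
  by (simp add: sym_group_mult sym_group_one S3_a_def)

lemma S3_a_pow: "even k \<Longrightarrow> S3_a [^]\<^bsub>sym_group 3\<^esub> (k::nat) = \<one>\<^bsub>sym_group 3\<^esub>"
proof -
  assume "even k"
  then obtain j where "k = 2 * j" by (elim evenE)
  moreover have "S3_a [^]\<^bsub>sym_group 3\<^esub> (2::nat) = \<one>\<^bsub>sym_group 3\<^esub>"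
    using S3_a_sq by (simp add: numeral_2_eq_2)
  ultimately show ?thesis by (simp add: S3.nat_pow_pow[symmetric])
qed

text \<open>For n >= 1 the exponent 2^n is even, so a transposition satisfies the first relation.
  This model of the relations shows that \<open>b\<close> is nontrivial in G_n.\<close>

lemma Gn_hom_S3:
  assumes "n \<ge> 1"
  obtains h where "h \<in> hom (Gn n) (sym_group 3)" "h (Gn_a n) = S3_a" "h (Gn_b n) = S3_b"
  using Gn_hom[OF S3.group_axioms S3.a_closed S3.b_closed _ S3.b_sq S3.conj_a_b, of n]
    S3_a_pow[of "2 ^ n"] assms by auto

lemma Gn_b_ne_one: "n \<ge> 1 \<Longrightarrow> Gn_b n \<noteq> \<one>\<^bsub>Gn n\<^esub>"
proof
  assume n: "n \<ge> 1" and "Gn_b n = \<one>\<^bsub>Gn n\<^esub>"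
  obtain h where "h \<in> hom (Gn n) (sym_group 3)" "h (Gn_b n) = S3_b" using Gn_hom_S3[OF n] by metis
  then show False using hom_one[OF _ group_Gn S3.group_axioms] S3.b_ne \<open>Gn_b n = _\<close> by metis
qed

lemma inverting_pair_Gn: "n \<ge> 1 \<Longrightarrow> inverting_pair (Gn n) (Gn_a n) (Gn_b n)"
  by unfold_locales (simp_all add: Gn_conj Gn_b_sq Gn_b_ne_one)

text \<open>Only existence is claimed. Words are built by prepending letters, and the set of normal
  forms is stable under left multiplication by powers of \<open>a\<close> and by elements of
  \<open>K\<close>.\<close>

lemma Gn_normal_form:
  assumes n: "n \<ge> 1" and u: "u \<in> carrier (Gn n)"
  shows "\<exists>i :: nat. \<exists>c\<in>inverting_pair.K (Gn n) (Gn_b n). u = Gn_a n [^]\<^bsub>Gn n\<^esub> i \<otimes>\<^bsub>Gn n\<^esub> c"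
proof -
  interpret P: inverting_pair "Gn n" "Gn_a n" "Gn_b n" by (rule inverting_pair_Gn[OF n])
  define N where "N = {Gn_a n [^]\<^bsub>Gn n\<^esub> i \<otimes>\<^bsub>Gn n\<^esub> c | (i :: nat) c. c \<in> P.K}"
  have powN: "Gn_a n [^]\<^bsub>Gn n\<^esub> j \<otimes>\<^bsub>Gn n\<^esub> v \<in> N" if v: "v \<in> N" for v and j :: nat
  proof -
    obtain i c where c: "c \<in> P.K" "v = Gn_a n [^]\<^bsub>Gn n\<^esub> (i :: nat) \<otimes>\<^bsub>Gn n\<^esub> c"
      using v unfolding N_def by blast
    have "Gn_a n [^]\<^bsub>Gn n\<^esub> j \<otimes>\<^bsub>Gn n\<^esub> v = Gn_a n [^]\<^bsub>Gn n\<^esub> (j + i) \<otimes>\<^bsub>Gn n\<^esub> c"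
      unfolding c(2) using P.K_closed[OF c(1)] by (simp add: Gn.m_assoc flip: Gn.nat_pow_mult)
    then show ?thesis unfolding N_def using c(1) by blast
  qed
  have KN: "d \<otimes>\<^bsub>Gn n\<^esub> v \<in> N" if d: "d \<in> P.K" and v: "v \<in> N" for d v
  proof -
    obtain i c where c: "c \<in> P.K" "v = Gn_a n [^]\<^bsub>Gn n\<^esub> (i :: nat) \<otimes>\<^bsub>Gn n\<^esub> c"
      using v unfolding N_def by blast
    obtain d' where d': "d' \<in> P.K" "d \<otimes>\<^bsub>Gn n\<^esub> Gn_a n [^]\<^bsub>Gn n\<^esub> i = Gn_a n [^]\<^bsub>Gn n\<^esub> i \<otimes>\<^bsub>Gn n\<^esub> d'"
      using P.K_mult_pow_a[OF d] by blast
    have "d \<otimes>\<^bsub>Gn n\<^esub> v = (d \<otimes>\<^bsub>Gn n\<^esub> Gn_a n [^]\<^bsub>Gn n\<^esub> i) \<otimes>\<^bsub>Gn n\<^esub> c"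
      unfolding c(2) using P.K_closed[OF c(1)] P.K_closed[OF d] by (simp add: Gn.m_assoc)
    also have "\<dots> = Gn_a n [^]\<^bsub>Gn n\<^esub> i \<otimes>\<^bsub>Gn n\<^esub> (d' \<otimes>\<^bsub>Gn n\<^esub> c)"
      unfolding d'(2) using P.K_closed[OF c(1)] P.K_closed[OF d'(1)] by (simp add: Gn.m_assoc)
    finally show ?thesis unfolding N_def using P.K_mult[OF d'(1) c(1)] by blast
  qed
  \<comment> \<open>Natural exponents suffice, since the letter a^-1 acts as a power of
    \<open>a\<close>.\<close>
  have inv_a: "inv\<^bsub>Gn n\<^esub> Gn_a n = Gn_a n [^]\<^bsub>Gn n\<^esub> (2 ^ n - 1 :: nat)"
  proof (rule Gn.inv_equality)
    have "Gn_a n [^]\<^bsub>Gn n\<^esub> (2 ^ n - 1 :: nat) \<otimes>\<^bsub>Gn n\<^esub> Gn_a n = Gn_a n [^]\<^bsub>Gn n\<^esub> Suc (2 ^ n - 1)"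
      by (rule Gn.nat_pow_Suc[symmetric])
    also have "Suc (2 ^ n - 1) = 2 ^ n" by simp
    finally show "Gn_a n [^]\<^bsub>Gn n\<^esub> (2 ^ n - 1 :: nat) \<otimes>\<^bsub>Gn n\<^esub> Gn_a n = \<one>\<^bsub>Gn n\<^esub>"
      unfolding Gn_a_pow .
  qed simp_all
  have "word_class (Gn_rels n) w \<in> N" for w
  proof (induction w)
    case Nil
    have "word_class (Gn_rels n) [] = \<one>\<^bsub>Gn n\<^esub>" by (simp add: Gn_def one_presented_group)
    then have "word_class (Gn_rels n) [] = Gn_a n [^]\<^bsub>Gn n\<^esub> (0 :: nat) \<otimes>\<^bsub>Gn n\<^esub> \<one>\<^bsub>Gn n\<^esub>"
      by simp
    then show ?case unfolding N_def P.K_def by blast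
  next
    case (Cons l w)
    obtain x s where l: "l = (x, s)" by (cases l)
    have *: "word_class (Gn_rels n) (l # w) = word_class (Gn_rels n) [l] \<otimes>\<^bsub>Gn n\<^esub> word_class (Gn_rels n) w"
      by (simp add: Gn_def mult_presented_group)
    have a: "word_class (Gn_rels n) [(Gen_a, False)] = inv\<^bsub>Gn n\<^esub> Gn_a n"
      and b: "word_class (Gn_rels n) [(Gen_b, False)] = inv\<^bsub>Gn n\<^esub> Gn_b n"
      by (simp_all add: Gn_def Gn_a_def Gn_b_def inv_word_class)
    show ?case
    proof (cases x)
      case Gen_a
      show ?thesis
      proof (cases s)
        case True
        then show ?thesis
          using powN[OF Cons, of 1] unfolding * unfolding l Gen_a by (simp flip: Gn_a_def)
      next
        case False
        then show ?thesis
          using powN[OF Cons, of "2 ^ n - 1"] unfolding * unfolding l Gen_a by (simp add: a inv_a)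
      qed
    next
      case Gen_b
      have "word_class (Gn_rels n) [l] \<in> P.K"
        unfolding l Gen_b P.K_def by (cases s) (simp_all add: b Gn_b_def[symmetric])
      then show ?thesis unfolding * by (rule KN[OF _ Cons])
    qed
  qed
  then have "u \<in> N" using u unfolding Gn_def by (elim presented_group_cases) simp
  then show ?thesis unfolding N_def by blast
qed

section \<open>Decomposition of the group\<close>

lemma inverting_pair_hom:
  assumes P: "inverting_pair P a b" and H: "inverting_pair H a' b'"
    and h: "h \<in> hom P H" "h a = a'" "h b = b'"
  shows "h ` inverting_pair.K P b = inverting_pair.K H b'"
    and "c \<in> inverting_pair.K P b \<Longrightarrow> h c = \<one>\<^bsub>H\<^esub> \<Longrightarrow> c = \<one>\<^bsub>P\<^esub>"
    and "c \<in> inverting_pair.K P b \<Longrightarrow> h (a [^]\<^bsub>P\<^esub> (i::nat) \<otimes>\<^bsub>P\<^esub> c) = a' [^]\<^bsub>H\<^esub> i \<otimes>\<^bsub>H\<^esub> h c"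
proof -
  interpret P: inverting_pair P a b by (rule P)
  interpret H: inverting_pair H a' b' by (rule H)
  interpret h: group_hom P H h by unfold_locales (rule h(1))
  have inv: "h (inv\<^bsub>P\<^esub> b) = inv\<^bsub>H\<^esub> b'" by (simp add: h(3))
  then show "h ` P.K = H.K" by (simp add: P.K_def H.K_def h(3))
  show "c = \<one>\<^bsub>P\<^esub>" if "c \<in> P.K" "h c = \<one>\<^bsub>H\<^esub>"
    using that inv H.b_ne H.inv_b_ne(2) by (auto simp: P.K_def h(3))
  show "h (a [^]\<^bsub>P\<^esub> (i::nat) \<otimes>\<^bsub>P\<^esub> c) = a' [^]\<^bsub>H\<^esub> i \<otimes>\<^bsub>H\<^esub> h c" if "c \<in> P.K"
    using P.K_closed[OF that] by (simp add: h.hom_nat_pow h(2))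
qed

text \<open>The record is built anew instead of updating the carrier of \<open>G\<close>, so that it
  has type \<open>'a monoid\<close> whatever extension fields \<open>G\<close> has.\<close>

lemma (in group) central_subgroup_comm_group:
  assumes C: "subgroup C G" and CZ: "C \<subseteq> center G"
  shows "comm_group \<lparr>carrier = C, monoid.mult = monoid.mult G, one = \<one>\<rparr>"
proof -
  interpret C: subgroup C G by (rule C)
  show ?thesis
  proof (rule comm_groupI; simp add: m_assoc)
    show "x \<otimes> y = y \<otimes> x" if "x \<in> C" "y \<in> C" for x y
      using that CZ by (intro center_commutes) auto
    show "\<exists>y\<in>C. y \<otimes> x = \<one>" if "x \<in> C" for x
      using that by (intro bexI[of _ "inv x"]) auto
  qed
qed

text \<open>\<open>S3.K\<close> and its coset of the transposition are disjoint with three elements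
  each, which exhausts the six permutations.\<close>

lemma S3_cases:
  assumes p: "p \<in> carrier (sym_group 3)"
  obtains i c where "c \<in> S3.K" "p = S3_a [^]\<^bsub>sym_group 3\<^esub> (i::nat) \<otimes>\<^bsub>sym_group 3\<^esub> c"
proof -
  let ?aK = "(\<lambda>c. S3_a \<otimes>\<^bsub>sym_group 3\<^esub> c) ` S3.K"
  have "S3.K \<inter> ?aK = {}"
  proof (rule ccontr)
    assume "S3.K \<inter> ?aK \<noteq> {}"
    then obtain c d where c: "c \<in> S3.K" "d \<in> S3.K" "d = S3_a \<otimes>\<^bsub>sym_group 3\<^esub> c" by blast
    then have "S3_a = d \<otimes>\<^bsub>sym_group 3\<^esub> inv\<^bsub>sym_group 3\<^esub> c"
      using S3.K_closed[OF c(1)] by (simp only: S3.m_assoc S3.r_inv S3.r_one S3.a_closed S3.inv_closed)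
    then show False using S3.K_mult[OF c(2) S3.K_inv[OF c(1)]] S3.a_notin_K by metis
  qed
  moreover have "card ?aK = card S3.K"
    by (rule card_image) (meson S3.K_closed S3.a_closed inj_onI S3.l_cancel)
  moreover have "finite S3.K" by (simp add: S3.K_def)
  ultimately have "card (S3.K \<union> ?aK) = 6" using S3.card_K by (simp add: card_Un_disjoint)
  moreover have "card (carrier (sym_group 3)) = 6"
    by (simp add: sym_group_card_carrier fact_numeral)
  moreover have "S3.K \<union> ?aK \<subseteq> carrier (sym_group 3)"
    using S3.K_closed S3.m_closed[OF S3.a_closed] by blast
  ultimately have "S3.K \<union> ?aK = carrier (sym_group 3)"
    by (intro card_subset_eq) (auto intro: card_ge_0_finite)
  then consider "p \<in> S3.K" | "p \<in> ?aK" using p by blast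
  then show thesis
  proof cases
    case 1
    then have "p = S3_a [^]\<^bsub>sym_group 3\<^esub> (0::nat) \<otimes>\<^bsub>sym_group 3\<^esub> p" using p by simp
    with 1 show ?thesis by (rule that)
  next
    case 2
    then obtain c where c: "c \<in> S3.K" "p = S3_a \<otimes>\<^bsub>sym_group 3\<^esub> c" by blast
    then have "p = S3_a [^]\<^bsub>sym_group 3\<^esub> (1::nat) \<otimes>\<^bsub>sym_group 3\<^esub> c" by simp
    with c(1) show ?thesis by (rule that)
  qed
qed

text \<open>Moving \<open>a\<close> across an element of \<open>K\<close> inverts that element;
  doing so twice restores it.\<close>

lemma Gn_a_sq_central:
  assumes n: "n \<ge> 1"
  shows "Gn_a n \<otimes>\<^bsub>Gn n\<^esub> Gn_a n \<in> center (Gn n)"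
proof (rule Gn.centerI)
  interpret P: inverting_pair "Gn n" "Gn_a n" "Gn_b n" by (rule inverting_pair_Gn[OF n])
  let ?A = "Gn_a n"
  fix u assume "u \<in> carrier (Gn n)"
  then obtain i c where c: "c \<in> P.K" "u = ?A [^]\<^bsub>Gn n\<^esub> (i::nat) \<otimes>\<^bsub>Gn n\<^esub> c"
    using Gn_normal_form[OF n] by blast
  have cG: "c \<in> carrier (Gn n)" by (rule P.K_closed[OF c(1)])
  have ci: "c \<otimes>\<^bsub>Gn n\<^esub> ?A = ?A \<otimes>\<^bsub>Gn n\<^esub> inv\<^bsub>Gn n\<^esub> c"
    "inv\<^bsub>Gn n\<^esub> c \<otimes>\<^bsub>Gn n\<^esub> ?A = ?A \<otimes>\<^bsub>Gn n\<^esub> c"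
    using P.K_mult_a[OF c(1)] P.K_mult_a[OF P.K_inv[OF c(1)]] cG by simp_all
  have ai: "?A [^]\<^bsub>Gn n\<^esub> i \<otimes>\<^bsub>Gn n\<^esub> (?A \<otimes>\<^bsub>Gn n\<^esub> ?A) = (?A \<otimes>\<^bsub>Gn n\<^esub> ?A) \<otimes>\<^bsub>Gn n\<^esub> ?A [^]\<^bsub>Gn n\<^esub> i"
    using Gn.nat_pow_comm[of ?A n i 2] by (simp add: numeral_2_eq_2)
  have "c \<otimes>\<^bsub>Gn n\<^esub> (?A \<otimes>\<^bsub>Gn n\<^esub> ?A) = (?A \<otimes>\<^bsub>Gn n\<^esub> ?A) \<otimes>\<^bsub>Gn n\<^esub> c"
  proof -
    have "c \<otimes>\<^bsub>Gn n\<^esub> (?A \<otimes>\<^bsub>Gn n\<^esub> ?A) = (c \<otimes>\<^bsub>Gn n\<^esub> ?A) \<otimes>\<^bsub>Gn n\<^esub> ?A"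
      using cG by (simp only: Gn.m_assoc Gn_a_closed)
    also have "\<dots> = ?A \<otimes>\<^bsub>Gn n\<^esub> (inv\<^bsub>Gn n\<^esub> c \<otimes>\<^bsub>Gn n\<^esub> ?A)"
      unfolding ci(1) using cG by (simp only: Gn.m_assoc Gn_a_closed Gn.inv_closed)
    finally show ?thesis unfolding ci(2) using cG by (simp only: Gn.m_assoc Gn_a_closed)
  qed
  then have "u \<otimes>\<^bsub>Gn n\<^esub> (?A \<otimes>\<^bsub>Gn n\<^esub> ?A)
      = (?A [^]\<^bsub>Gn n\<^esub> i \<otimes>\<^bsub>Gn n\<^esub> (?A \<otimes>\<^bsub>Gn n\<^esub> ?A)) \<otimes>\<^bsub>Gn n\<^esub> c"
    unfolding c(2) using cG by (simp only: Gn.m_assoc Gn_a_closed Gn.nat_pow_closed Gn.m_closed)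
  also have "\<dots> = (?A \<otimes>\<^bsub>Gn n\<^esub> ?A) \<otimes>\<^bsub>Gn n\<^esub> u"
    unfolding ai c(2) using cG by (simp only: Gn.m_assoc Gn_a_closed Gn.nat_pow_closed Gn.m_closed)
  finally show "(?A \<otimes>\<^bsub>Gn n\<^esub> ?A) \<otimes>\<^bsub>Gn n\<^esub> u = u \<otimes>\<^bsub>Gn n\<^esub> (?A \<otimes>\<^bsub>Gn n\<^esub> ?A)" by simp
qed simp

lemma cs_Gn_times_abelian:
  assumes n: "n \<ge> 1" and C: "comm_group C"
  shows "cs (Gn n \<times>\<times> C) = {1, 2, 3}"
proof -
  interpret C: comm_group C by (rule C)
  interpret P: inverting_pair "Gn n" "Gn_a n" "Gn_b n" by (rule inverting_pair_Gn[OF n])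
  let ?G = "Gn n \<times>\<times> C" and ?a = "(Gn_a n, \<one>\<^bsub>C\<^esub>)" and ?b = "(Gn_b n, \<one>\<^bsub>C\<^esub>)"
  interpret D: group ?G by (rule DirProd_group) (rule group_Gn C.group_axioms)+
  have conj: "D.conj (g, c) (h, d) = (Gn.conj n g h, d)"
    if "g \<in> carrier (Gn n)" "c \<in> carrier C" "h \<in> carrier (Gn n)" "d \<in> carrier C" for g c h d
    using that C.m_comm[of c d]
    by (simp add: D.conj_def Gn.conj_def inv_DirProd[OF group_Gn C.group_axioms] C.m_assoc)
  have inv_b: "inv\<^bsub>?G\<^esub> ?b = (inv\<^bsub>Gn n\<^esub> Gn_b n, \<one>\<^bsub>C\<^esub>)"
    using inv_DirProd[OF group_Gn C.group_axioms, of "Gn_b n" n "\<one>\<^bsub>C\<^esub>"] by simp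
  interpret D: inverting_pair ?G ?a ?b
  proof
    show "D.conj ?a ?b = inv\<^bsub>?G\<^esub> ?b" unfolding inv_b by (simp add: conj Gn_conj)
    show "?b \<otimes>\<^bsub>?G\<^esub> ?b = inv\<^bsub>?G\<^esub> ?b" unfolding inv_b by (simp add: Gn_b_sq)
    show "?b \<noteq> \<one>\<^bsub>?G\<^esub>" using P.b_ne by simp
  qed simp_all
  have K: "(c, \<one>\<^bsub>C\<^esub>) \<in> D.K" if "c \<in> P.K" for c
    using that unfolding D.K_def P.K_def inv_b by auto
  show ?thesis
  proof (rule D.cs_eq_123)
    fix g assume g: "g \<in> carrier ?G"
    obtain u c where uc: "g = (u, c)" by (cases g)
    then have uG: "u \<in> carrier (Gn n)" and cC: "c \<in> carrier C" using g by simp_all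
    obtain i d where d: "d \<in> P.K" "u = Gn_a n [^]\<^bsub>Gn n\<^esub> (i::nat) \<otimes>\<^bsub>Gn n\<^esub> d"
      using Gn_normal_form[OF n uG] by blast
    have dG: "d \<in> carrier (Gn n)" by (rule P.K_closed[OF d(1)])
    \<comment> \<open>The even part of a^i is central, leaving at most one factor
      \<open>a\<close>.\<close>
    define z where "z = (Gn_a n \<otimes>\<^bsub>Gn n\<^esub> Gn_a n) [^]\<^bsub>Gn n\<^esub> (i div 2)"
    have z: "z \<in> center (Gn n)"
      unfolding z_def
      by (intro subgroup.nat_pow_mem[OF Gn.center_subgroup] Gn_a_sq_central[OF n])
    have zG: "z \<in> carrier (Gn n)" by (rule Gn.center_closed[OF z])
    have zc: "(z, c) \<in> center ?G"
    proof (rule D.centerI)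
      show "(z, c) \<in> carrier ?G" using zG cC by simp
      show "(z, c) \<otimes>\<^bsub>?G\<^esub> h = h \<otimes>\<^bsub>?G\<^esub> (z, c)" if "h \<in> carrier ?G" for h
        using that Gn.center_commutes[OF z] C.m_comm[OF cC] by (cases h) simp
    qed
    have z': "z = Gn_a n [^]\<^bsub>Gn n\<^esub> (2 * (i div 2))"
      unfolding z_def using Gn.nat_pow_pow[of "Gn_a n" n 2 "i div 2"] by (simp add: numeral_2_eq_2)
    show "\<exists>z\<in>center ?G. \<exists>c\<in>D.K. g = z \<otimes>\<^bsub>?G\<^esub> c \<or> g = z \<otimes>\<^bsub>?G\<^esub> (?a \<otimes>\<^bsub>?G\<^esub> c)"
    proof (cases "even i")
      case True
      then have "g = (z, c) \<otimes>\<^bsub>?G\<^esub> (d, \<one>\<^bsub>C\<^esub>)" unfolding uc d(2) z' using cC by simp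
      then show ?thesis using zc K[OF d(1)] by blast
    next
      case False
      then have "i = Suc (2 * (i div 2))" by presburger
      then have "Gn_a n [^]\<^bsub>Gn n\<^esub> i = z \<otimes>\<^bsub>Gn n\<^esub> Gn_a n" unfolding z' by (metis Gn.nat_pow_Suc)
      then have "g = (z, c) \<otimes>\<^bsub>?G\<^esub> (?a \<otimes>\<^bsub>?G\<^esub> (d, \<one>\<^bsub>C\<^esub>))"
        unfolding uc d(2) using cC zG dG by (simp add: Gn.m_assoc)
      then show ?thesis using zc K[OF d(1)] by blast
    qed
  qed
qed

context inverting_pair
begin

text \<open>The universal property gives a map h from G_n, and (u, c) -> h(u) c is the isomorphism:
  centrality of \<open>C\<close> makes it a homomorphism, \<open>gen\<close> gives surjectivity and
  \<open>aC\<close> injectivity. The quotient comes from carrying the map G_n -> S_3 over to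
  \<open>G\<close>.\<close>

lemma Gn_times_central_decomposition:
  assumes sq: "a \<otimes> a \<in> center G" and C: "subgroup C G" and CZ: "C \<subseteq> center G" and n: "n \<ge> 1"
    and an: "a [^] (2 ^ n :: nat) = \<one>" and aC: "\<And>i :: nat. a [^] i \<in> C \<Longrightarrow> 2 ^ n dvd i"
    and gen: "\<And>g. g \<in> carrier G \<Longrightarrow> \<exists>i :: nat. \<exists>k\<in>K. \<exists>c\<in>C. g = a [^] i \<otimes> k \<otimes> c"
  defines "D \<equiv> \<lparr>carrier = C, monoid.mult = monoid.mult G, one = \<one>\<rparr>"
  shows "\<exists>\<phi>\<in>iso G (Gn n \<times>\<times> D).
      \<phi> ` center G = generate (Gn n) {Gn_a n [^]\<^bsub>Gn n\<^esub> (2::nat)} \<times> carrier D"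
    and "G Mod center G \<cong> sym_group 3"
proof -
  interpret C: subgroup C G by (rule C)
  interpret P: inverting_pair "Gn n" "Gn_a n" "Gn_b n" by (rule inverting_pair_Gn[OF n])
  interpret D: group D
    unfolding D_def by (rule comm_group.axioms(2)[OF central_subgroup_comm_group[OF C CZ]])
  obtain h where h: "h \<in> hom (Gn n) G" "h (Gn_a n) = a" "h (Gn_b n) = b"
    using Gn_hom[OF group_axioms a_closed b_closed an b_sq conj_a_b] by blast
  obtain s where s: "s \<in> hom (Gn n) (sym_group 3)" "s (Gn_a n) = S3_a" "s (Gn_b n) = S3_b"
    using Gn_hom_S3[OF n] by blast
  note hK = inverting_pair_hom[OF P.inverting_pair_axioms inverting_pair_axioms h]
  note sK = inverting_pair_hom[OF P.inverting_pair_axioms S3.inverting_pair_axioms s]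
  interpret h: group_hom "Gn n" G h by unfold_locales (rule h(1))
  interpret s: group_hom "Gn n" "sym_group 3" s by unfold_locales (rule s(1))
  define \<psi> where "\<psi> = (\<lambda>(u, c). h u \<otimes> c)"
  let ?GD = "Gn n \<times>\<times> D"
  have GD: "group ?GD" by (rule DirProd_group) (rule group_Gn D.group_axioms)+
  have carD: "carrier D = C" by (simp add: D_def)
  have cG: "c \<in> carrier G" "c \<in> center G" if "c \<in> C" for c using that CZ by auto
  have "\<psi> \<in> hom ?GD G"
  proof (rule homI)
    show "\<psi> w \<in> carrier G" if "w \<in> carrier ?GD" for w
      using that by (auto simp: \<psi>_def carD)
    show "\<psi> (v \<otimes>\<^bsub>?GD\<^esub> w) = \<psi> v \<otimes> \<psi> w" if vw: "v \<in> carrier ?GD" "w \<in> carrier ?GD" for v w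
    proof -
      obtain u c u' c' where v: "v = (u, c)" "w = (u', c')" by (cases v, cases w)
      then have G: "h u \<in> carrier G" "h u' \<in> carrier G" "c \<in> carrier G" "c' \<in> carrier G"
        and u: "u \<in> carrier (Gn n)" "u' \<in> carrier (Gn n)" and c: "c \<in> C"
        using vw by (simp_all add: carD)
      have "\<psi> (v \<otimes>\<^bsub>?GD\<^esub> w) = h u \<otimes> (h u' \<otimes> c) \<otimes> c'"
        using u G unfolding \<psi>_def v by (simp add: D_def m_assoc)
      also have "h u' \<otimes> c = c \<otimes> h u'" using center_commutes[OF cG(2)[OF c] G(2)] by simp
      finally show ?thesis unfolding \<psi>_def v using G by (simp add: m_assoc)
    qed
  qed
  then interpret \<psi>: group_hom ?GD G \<psi>
    by (simp add: group_hom_def group_hom_axioms_def GD group_axioms)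
  have surj: "\<psi> ` carrier ?GD = carrier G"
  proof
    show "carrier G \<subseteq> \<psi> ` carrier ?GD"
    proof
      fix g assume "g \<in> carrier G"
      then obtain i k c where g: "k \<in> K" "c \<in> C" "g = a [^] (i::nat) \<otimes> k \<otimes> c" using gen by blast
      obtain k' where k': "k' \<in> P.K" "k = h k'" using g(1) hK(1) by blast
      have "g = \<psi> (Gn_a n [^]\<^bsub>Gn n\<^esub> i \<otimes>\<^bsub>Gn n\<^esub> k', c)"
        unfolding \<psi>_def g(3) k'(2) using hK(3)[OF k'(1)] by simp
      then show "g \<in> \<psi> ` carrier ?GD" using P.K_closed[OF k'(1)] g(2) by (simp add: carD)
    qed
  qed (use \<psi>.hom_closed in blast)
  have inj: "inj_on \<psi> (carrier ?GD)"
  proof -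
    \<comment> \<open>Triviality of a^i h(k) c makes a^i h(k) central, so h(k) = 1 and a^i lies in
      \<open>C\<close>. Then 2^n divides i, and the first relation of the presentation makes the
      power of the generator vanish in G_n as well.\<close>
    have "w = \<one>\<^bsub>?GD\<^esub>" if w: "w \<in> carrier ?GD" "\<psi> w = \<one>" for w
    proof -
      obtain u c where uc: "w = (u, c)" "u \<in> carrier (Gn n)" "c \<in> C" using w(1) by (cases w) (simp add: carD)
      obtain i k where k: "k \<in> P.K" "u = Gn_a n [^]\<^bsub>Gn n\<^esub> (i::nat) \<otimes>\<^bsub>Gn n\<^esub> k"
        using Gn_normal_form[OF n uc(2)] by blast
      have hk: "h k \<in> K" using k(1) hK(1) by blast
      have kG: "h k \<in> carrier G" by (rule K_closed[OF hk])
      have one: "a [^] i \<otimes> h k \<otimes> c = \<one>"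
        using w(2) unfolding \<psi>_def uc(1) k(2) by (simp add: hK(3)[OF k(1)])
      then have ak: "a [^] i \<otimes> h k = inv c" using kG cG[OF uc(3)]
        by (metis a_closed inv_equality inv_inv m_closed nat_pow_closed)
      then have "a [^] i \<otimes> h k \<in> center G" using CZ C.m_inv_closed[OF uc(3)] by auto
      from pow_a_mult_K_central(2)[OF sq hk this] have h1: "h k = \<one>" .
      then have k1: "k = \<one>\<^bsub>Gn n\<^esub>" by (rule hK(2)[OF k(1)])
      have ai: "a [^] i = inv c" using ak h1 by simp
      then have "2 ^ n dvd i" using C.m_inv_closed[OF uc(3)] by (intro aC) simp
      then obtain j where j: "i = 2 ^ n * j" by (elim dvdE)
      have "a [^] i = \<one>" "Gn_a n [^]\<^bsub>Gn n\<^esub> i = \<one>\<^bsub>Gn n\<^esub>"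
        unfolding j using an Gn_a_pow[of n]
        by (simp_all add: nat_pow_pow[symmetric] Gn.nat_pow_pow[symmetric])
      moreover from this have "c = \<one>" using ai cG[OF uc(3)] by (metis inv_inv inv_one)
      ultimately show ?thesis unfolding uc(1) k(2) k1 by (simp add: D_def)
    qed
    then show ?thesis using \<psi>.inj_on_one_iff by auto
  qed
  have iso: "\<psi> \<in> iso ?GD G"
    using \<psi>.homh inj surj by (simp add: iso_def bij_betw_def)
  define \<phi> where "\<phi> = inv_into (carrier ?GD) \<psi>"
  have \<phi>: "\<phi> \<in> iso G ?GD" unfolding \<phi>_def by (rule group.iso_set_sym[OF GD iso])
  have center: "\<psi> ` (generate (Gn n) {Gn_a n [^]\<^bsub>Gn n\<^esub> (2::nat)} \<times> C) = center G"
  proof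
    have aa: "h (Gn_a n [^]\<^bsub>Gn n\<^esub> (2::nat)) = a \<otimes> a"
      by (simp add: h.hom_nat_pow h(2) numeral_2_eq_2)
    have "h ` generate (Gn n) {Gn_a n [^]\<^bsub>Gn n\<^esub> (2::nat)} = generate G {a \<otimes> a}"
      using h.generate_img[of "{Gn_a n [^]\<^bsub>Gn n\<^esub> (2::nat)}"] aa by simp
    also have "\<dots> \<subseteq> center G"
      using sq by (intro generate_subgroup_incl[OF _ center_subgroup]) simp
    finally have "h u \<otimes> c \<in> center G" if "u \<in> generate (Gn n) {Gn_a n [^]\<^bsub>Gn n\<^esub> (2::nat)}" "c \<in> C" for u c
      using that CZ by (intro subgroup.m_closed[OF center_subgroup]) blast+
    then show "\<psi> ` (generate (Gn n) {Gn_a n [^]\<^bsub>Gn n\<^esub> (2::nat)} \<times> C) \<subseteq> center G"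
      by (auto simp: \<psi>_def)
    \<comment> \<open>Dividing a central element by its factor in \<open>C\<close> leaves a central
      a^i k, which by the parity criterion is a power of a^2.\<close>
    show "center G \<subseteq> \<psi> ` (generate (Gn n) {Gn_a n [^]\<^bsub>Gn n\<^esub> (2::nat)} \<times> C)"
    proof
      fix g assume g: "g \<in> center G"
      then obtain i k c where kc: "k \<in> K" "c \<in> C" "g = a [^] (i::nat) \<otimes> k \<otimes> c"
        using gen center_closed by blast
      have kG: "k \<in> carrier G" by (rule K_closed[OF kc(1)])
      have "a [^] i \<otimes> k = g \<otimes> inv c" unfolding kc(3) using kG cG[OF kc(2)] by (simp add: m_assoc)
      also have "\<dots> \<in> center G"
        using g CZ C.m_inv_closed[OF kc(2)] by (intro subgroup.m_closed[OF center_subgroup]) auto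
      finally have ak: "a [^] i \<otimes> k \<in> center G" .
      obtain j where j: "i = 2 * j" using pow_a_mult_K_central(1)[OF sq kc(1) ak] by (elim evenE)
      define u where "u = (Gn_a n [^]\<^bsub>Gn n\<^esub> (2::nat)) [^]\<^bsub>Gn n\<^esub> j"
      have "u \<in> generate (Gn n) {Gn_a n [^]\<^bsub>Gn n\<^esub> (2::nat)}"
        unfolding u_def
        by (intro subgroup.nat_pow_mem[OF Gn.generate_is_subgroup] generate.incl) simp_all
      moreover have "\<psi> (u, c) = g"
        unfolding \<psi>_def u_def kc(3) j pow_a_mult_K_central(2)[OF sq kc(1) ak]
        by (simp add: Gn.nat_pow_pow h.hom_nat_pow h(2))
      ultimately show "g \<in> \<psi> ` (generate (Gn n) {Gn_a n [^]\<^bsub>Gn n\<^esub> (2::nat)} \<times> C)"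
        using kc(2) by blast
    qed
  qed
  have "generate (Gn n) {Gn_a n [^]\<^bsub>Gn n\<^esub> (2::nat)} \<subseteq> carrier (Gn n)"
    by (rule Gn.generate_incl) simp
  then have "\<phi> ` center G = generate (Gn n) {Gn_a n [^]\<^bsub>Gn n\<^esub> (2::nat)} \<times> carrier D"
    unfolding \<phi>_def center[symmetric] carD
    by (intro inv_into_image_cancel[OF inj]) (auto simp: carD)
  then show "\<exists>\<phi>\<in>iso G ?GD.
      \<phi> ` center G = generate (Gn n) {Gn_a n [^]\<^bsub>Gn n\<^esub> (2::nat)} \<times> carrier D"
    using \<phi> by blast
  define f where "f = (\<lambda>g. s (fst (\<phi> g)))"
  have \<phi>_hom: "\<phi> \<in> hom G ?GD" using \<phi> by (simp add: iso_def)
  have f_hom: "f \<in> hom G (sym_group 3)"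
  proof (rule homI)
    have \<phi>G: "fst (\<phi> g) \<in> carrier (Gn n)" if "g \<in> carrier G" for g
      using hom_in_carrier[OF \<phi>_hom that] by auto
    then show "f g \<in> carrier (sym_group 3)" if "g \<in> carrier G" for g
      using that unfolding f_def by (intro s.hom_closed)
    show "f (g \<otimes> g') = f g \<otimes>\<^bsub>sym_group 3\<^esub> f g'" if "g \<in> carrier G" "g' \<in> carrier G" for g g'
      unfolding f_def hom_mult[OF \<phi>_hom that] mult_DirProd' using \<phi>G that by simp
  qed
  interpret f: group_hom G "sym_group 3" f by unfold_locales (rule f_hom)
  have f\<psi>: "f (\<psi> (u, c)) = s u" if "u \<in> carrier (Gn n)" "c \<in> C" for u c
    unfolding f_def \<phi>_def using that inv_into_f_f[OF inj] by (simp add: carD)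
  \<comment> \<open>The parity criterion is used twice: in S_3, where the identity is central, and
    in \<open>G\<close>. On both sides it says that i is even and the \<open>K\<close>-part is
    trivial.\<close>
  have ker: "f g = \<one>\<^bsub>sym_group 3\<^esub> \<longleftrightarrow> g \<in> center G" if gG: "g \<in> carrier G" for g
  proof -
    obtain i k c where kc: "k \<in> K" "c \<in> C" "g = a [^] (i::nat) \<otimes> k \<otimes> c"
      using gen[OF gG] by blast
    have kG: "k \<in> carrier G" by (rule K_closed[OF kc(1)])
    obtain k' where k': "k' \<in> P.K" "k = h k'" using kc(1) hK(1) by blast
    have "g = \<psi> (Gn_a n [^]\<^bsub>Gn n\<^esub> i \<otimes>\<^bsub>Gn n\<^esub> k', c)"
      unfolding \<psi>_def kc(3) k'(2) using hK(3)[OF k'(1)] by simp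
    then have fg: "f g = S3_a [^]\<^bsub>sym_group 3\<^esub> i \<otimes>\<^bsub>sym_group 3\<^esub> s k'"
      using f\<psi>[OF _ kc(2)] P.K_closed[OF k'(1)] sK(3)[OF k'(1)] by simp
    have sk: "s k' \<in> S3.K" using k'(1) sK(1) by blast
    have one: "\<one>\<^bsub>sym_group 3\<^esub> \<in> center (sym_group 3)"
      by (rule subgroup.one_closed[OF S3.center_subgroup])
    have ak: "a [^] i \<otimes> k = g \<otimes> inv c" unfolding kc(3) using kG cG[OF kc(2)] by (simp add: m_assoc)
    show ?thesis
    proof
      assume "f g = \<one>\<^bsub>sym_group 3\<^esub>"
      then have *: "S3_a [^]\<^bsub>sym_group 3\<^esub> i \<otimes>\<^bsub>sym_group 3\<^esub> s k' \<in> center (sym_group 3)"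
        using fg one by simp
      have sq': "S3_a \<otimes>\<^bsub>sym_group 3\<^esub> S3_a \<in> center (sym_group 3)" unfolding S3_a_sq by (rule one)
      obtain j where j: "i = 2 * j" using S3.pow_a_mult_K_central(1)[OF sq' sk *] by (elim evenE)
      have "k' = \<one>\<^bsub>Gn n\<^esub>" by (rule sK(2)[OF k'(1) S3.pow_a_mult_K_central(2)[OF sq' sk *]])
      then have "k = \<one>" using k'(2) by simp
      then have "g = (a \<otimes> a) [^] j \<otimes> c"
        unfolding kc(3) j using nat_pow_pow[OF a_closed, of 2 j] by (simp add: numeral_2_eq_2)
      then show "g \<in> center G"
        using subgroup.m_closed[OF center_subgroup subgroup.nat_pow_mem[OF center_subgroup sq, of j]]
          cG[OF kc(2)] by simp
    next
      assume "g \<in> center G"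
      then have *: "a [^] i \<otimes> k \<in> center G"
        unfolding ak using CZ C.m_inv_closed[OF kc(2)]
        by (intro subgroup.m_closed[OF center_subgroup]) auto
      have "k = \<one>" by (rule pow_a_mult_K_central(2)[OF sq kc(1) *])
      then have "k' = \<one>\<^bsub>Gn n\<^esub>" using hK(2)[OF k'(1)] k'(2) by simp
      then show "f g = \<one>\<^bsub>sym_group 3\<^esub>"
        unfolding fg using S3_a_pow[OF pow_a_mult_K_central(1)[OF sq kc(1) *]] by simp
    qed
  qed
  have f_surj: "f ` carrier G = carrier (sym_group 3)"
  proof
    show "carrier (sym_group 3) \<subseteq> f ` carrier G"
    proof
      fix p assume "p \<in> carrier (sym_group 3)"
      then obtain i c where c: "c \<in> S3.K" "p = S3_a [^]\<^bsub>sym_group 3\<^esub> (i::nat) \<otimes>\<^bsub>sym_group 3\<^esub> c"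
        by (rule S3_cases)
      obtain k' where k': "k' \<in> P.K" "c = s k'" using c(1) sK(1) by blast
      define u where "u = Gn_a n [^]\<^bsub>Gn n\<^esub> i \<otimes>\<^bsub>Gn n\<^esub> k'"
      have uG: "u \<in> carrier (Gn n)" unfolding u_def using P.K_closed[OF k'(1)] by simp
      have "p = f (\<psi> (u, \<one>))"
        using f\<psi>[OF uG C.one_closed] sK(3)[OF k'(1), of i] unfolding u_def c(2) k'(2) by simp
      moreover have "\<psi> (u, \<one>) \<in> carrier G" using uG unfolding \<psi>_def by simp
      ultimately show "p \<in> f ` carrier G" by blast
    qed
  qed (use f.hom_closed in blast)
  have "kernel G (sym_group 3) f = center G"
    unfolding kernel_def using ker center_closed by blast
  then show "G Mod center G \<cong> sym_group 3" using f.FactGroup_iso[OF f_surj] by simp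
qed

end

context finite_group
begin

text \<open>The given \<open>x\<close> need not have 2-power order nor a central complement, so it
  is replaced by a better representative of its coset modulo the center.\<close>

lemma class_sizes_123_decomposition:
  assumes sizes: "\<And>g. g \<in> carrier G \<Longrightarrow> card (cls g) \<in> {1, 2, 3}"
    and x: "x \<in> carrier G" "card (cls x) = 3" and k: "k \<in> carrier G" "card (cls k) = 2"
    and k1: "\<one> \<notin> cls k" and stab: "rstab (cls x) = insert \<one> (cls k)"
  shows "\<exists>n\<ge>1. \<exists>C :: 'a monoid. comm_group C \<and> finite (carrier C) \<and>
             (\<exists>\<phi> \<in> iso G (Gn n \<times>\<times> C).
                \<phi> ` center G = generate (Gn n) {Gn_a n [^]\<^bsub>Gn n\<^esub> (2::nat)} \<times> carrier C) \<and>
             G Mod center G \<cong> sym_group 3"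
proof -
  from class_sizes_123[OF assms] have kne: "k \<noteq> \<one>" and kk: "k \<otimes> k = inv k"
    and xk: "conj x k = inv k" and xx: "x \<otimes> x \<in> center G"
    and gen: "\<And>g. g \<in> carrier G \<Longrightarrow>
      \<exists>z\<in>center G. \<exists>c\<in>{\<one>, k, inv k}. g = z \<otimes> c \<or> g = x \<otimes> (z \<otimes> c)"
    by blast+
  interpret Z: subgroup "center G" G by (rule center_subgroup)
  \<comment> \<open>\<open>H\<close> is abelian, being generated by the center and one further
    element, and contains the center with index two; so the splitting of abelian groups applies to
    it.\<close>
  define H where "H = center G \<union> (\<lambda>z. x \<otimes> z) ` center G"
  have ZH: "center G \<subseteq> H" unfolding H_def by blast
  have "x = x \<otimes> \<one>" using x(1) by simp
  then have xH: "x \<in> H" unfolding H_def using Z.one_closed by blast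
  have xz: "x \<otimes> z \<otimes> (x \<otimes> z') \<in> center G" if "z \<in> center G" "z' \<in> center G" for z z'
  proof -
    have G: "z \<in> carrier G" "z' \<in> carrier G" using that by simp_all
    have "x \<otimes> z \<otimes> (x \<otimes> z') = x \<otimes> (z \<otimes> x) \<otimes> z'" using G x(1) by (simp add: m_assoc)
    also have "\<dots> = (x \<otimes> x) \<otimes> (z \<otimes> z')"
      unfolding center_commutes[OF that(1) x(1)] using G x(1) by (simp add: m_assoc)
    finally show ?thesis using that xx by simp
  qed
  have sH: "subgroup H G"
  proof (rule finite_closed_subgroup)
    show "H \<subseteq> carrier G" unfolding H_def using x(1) by auto
    show "\<one> \<in> H" using ZH Z.one_closed by blast
    have l: "x \<otimes> z \<otimes> z' \<in> H" "z' \<otimes> (x \<otimes> z) \<in> H" if "z \<in> center G" "z' \<in> center G" for z z'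
    proof -
      have G: "z \<in> carrier G" "z' \<in> carrier G" using that by simp_all
      have "x \<otimes> z \<otimes> z' = x \<otimes> (z \<otimes> z')" using G x(1) by (simp add: m_assoc)
      then show 1: "x \<otimes> z \<otimes> z' \<in> H" unfolding H_def using that by simp
      then show "z' \<otimes> (x \<otimes> z) \<in> H" using center_commutes[OF that(2), of "x \<otimes> z"] G x(1) by simp
    qed
    show "u \<otimes> v \<in> H" if uv: "u \<in> H" "v \<in> H" for u v
    proof -
      have "u \<in> center G \<or> (\<exists>z\<in>center G. u = x \<otimes> z)" "v \<in> center G \<or> (\<exists>z\<in>center G. v = x \<otimes> z)"
        using uv unfolding H_def by blast+
      then show ?thesis
        using l subsetD[OF ZH xz] subsetD[OF ZH Z.m_closed] by (elim disjE bexE) simp_all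
    qed
  qed
  interpret H: subgroup H G by (rule sH)
  have comm: "u \<otimes> v = v \<otimes> u" if uv: "u \<in> H" "v \<in> H" for u v
  proof (cases "u \<in> center G \<or> v \<in> center G")
    case True
    then show ?thesis using center_commutes uv by (metis H.mem_carrier)
  next
    case False
    then obtain z z' where z: "z \<in> center G" "u = x \<otimes> z" "z' \<in> center G" "v = x \<otimes> z'"
      using uv unfolding H_def by blast
    have G: "z \<in> carrier G" "z' \<in> carrier G" using z by simp_all
    have swap: "x \<otimes> p \<otimes> (x \<otimes> q) = x \<otimes> x \<otimes> (p \<otimes> q)" if pq: "p \<in> center G" "q \<in> center G" for p q
    proof -
      have "p \<in> carrier G" "q \<in> carrier G" using pq by simp_all
      then show ?thesis using center_commutes[OF pq(1) x(1)] x(1) by (metis m_assoc m_closed)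
    qed
    show ?thesis
      unfolding z swap[OF z(1,3)] swap[OF z(3,1)] center_commutes[OF z(1) G(2)] ..
  qed
  interpret HG: comm_group "G\<lparr>carrier := H\<rparr>"
    by (rule group.group_comm_groupI[OF H.subgroup_is_group[OF group_axioms]]) (simp add: comm)
  have x_noncentral: "x \<notin> center G"
    using card_cls_eq_1_iff[OF x(1)] x(2) by simp
  have finH: "finite (carrier (G\<lparr>carrier := H\<rparr>))"
    using H.subset finite_carrier by (simp add: finite_subset)
  have "\<not> carrier (G\<lparr>carrier := H\<rparr>) \<subseteq> center G" using xH x_noncentral by auto
  moreover have "u \<otimes>\<^bsub>G\<lparr>carrier := H\<rparr>\<^esub> v \<in> center G"
    if "u \<in> carrier (G\<lparr>carrier := H\<rparr>)" "v \<in> carrier (G\<lparr>carrier := H\<rparr>)" "u \<notin> center G" "v \<notin> center G" for u v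
    using that xz unfolding H_def by auto
  ultimately obtain a C n where aH: "a \<in> carrier (G\<lparr>carrier := H\<rparr>)" "a \<notin> center G"
    and C: "subgroup C (G\<lparr>carrier := H\<rparr>)" "C \<subseteq> center G"
    and an: "a [^]\<^bsub>G\<lparr>carrier := H\<rparr>\<^esub> (2 ^ n :: nat) = \<one>\<^bsub>G\<lparr>carrier := H\<rparr>\<^esub>"
    and aC: "\<And>i :: nat. a [^]\<^bsub>G\<lparr>carrier := H\<rparr>\<^esub> i \<in> C \<Longrightarrow> 2 ^ n dvd i"
    and span: "\<And>y. y \<in> carrier (G\<lparr>carrier := H\<rparr>) \<Longrightarrow>
      \<exists>i :: nat. \<exists>c\<in>C. y = a [^]\<^bsub>G\<lparr>carrier := H\<rparr>\<^esub> i \<otimes>\<^bsub>G\<lparr>carrier := H\<rparr>\<^esub> c"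
    using HG.index_two_split[OF finH subgroup_incl[OF center_subgroup sH ZH]] by blast
  have CG: "subgroup C G" by (rule incl_subgroup[OF sH C(1)])
  interpret C: subgroup C G by (rule CG)
  note pow = nat_pow_consistent[symmetric]
  \<comment> \<open>A noncentral element of \<open>H\<close> differs from \<open>x\<close> by a
    central factor, so it inverts \<open>k\<close> just as \<open>x\<close> does.\<close>
  obtain z where z: "z \<in> center G" "a = x \<otimes> z" using aH unfolding H_def by auto
  have zG: "z \<in> carrier G" using z(1) by simp
  have aG: "a \<in> carrier G" unfolding z(2) using x(1) zG by simp
  have sq: "a \<otimes> a \<in> center G" unfolding z(2) by (rule xz[OF z(1) z(1)])
  have "conj a k = conj x (conj z k)" unfolding z(2) using x(1) zG k(1) by (simp add: conj_conj)
  also have "conj z k = k" using center_commutes[OF z(1) k(1)] zG k(1) by (simp add: conj_eq_iff)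
  finally have ak: "conj a k = inv k" using xk by simp
  interpret I: inverting_pair G a k by unfold_locales (fact aG k(1) ak kk kne)+
  have n1: "n \<ge> 1"
  proof (rule ccontr)
    assume "\<not> n \<ge> 1"
    then have "n = 0" by simp
    then have "a = \<one>" using an aG by (simp add: pow)
    then show False using aH(2) Z.one_closed by simp
  qed
  \<comment> \<open>Every element is a product of one from \<open>H\<close> and one from
    \<open>I.K\<close>; the factor from \<open>C\<close> is central and can be moved to the
    end.\<close>
  have "\<exists>i :: nat. \<exists>k'\<in>I.K. \<exists>c\<in>C. g = a [^] i \<otimes> k' \<otimes> c" if g: "g \<in> carrier G" for g
  proof -
    obtain w k' where w: "w \<in> center G" "k' \<in> I.K" "g = w \<otimes> k' \<or> g = x \<otimes> (w \<otimes> k')"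
      using gen[OF g] unfolding I.K_def by blast
    have G: "w \<in> carrier G" "k' \<in> carrier G" using w(1) I.K_closed[OF w(2)] by simp_all
    have "\<exists>y\<in>H. g = y \<otimes> k'"
      using w G x(1) unfolding H_def by (auto simp flip: m_assoc)
    then obtain y where y: "y \<in> H" "g = y \<otimes> k'" by blast
    then obtain i c where c: "c \<in> C" "y = a [^] (i::nat) \<otimes> c" using span[of y] by (auto simp: pow)
    have cG: "c \<in> carrier G" using c(1) by simp
    have "g = a [^] i \<otimes> (c \<otimes> k')" unfolding y(2) c(2) using aG cG G by (simp add: m_assoc)
    also have "c \<otimes> k' = k' \<otimes> c" using center_commutes[of c k'] C(2) c(1) G(2) by blast
    finally have "g = a [^] i \<otimes> k' \<otimes> c" using aG cG G by (simp add: m_assoc)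
    then show ?thesis using w(2) c(1) by blast
  qed
  note decomp = I.Gn_times_central_decomposition[OF sq CG C(2) n1 _ _ this]
  let ?D = "\<lparr>carrier = C, monoid.mult = monoid.mult G, one = \<one>\<rparr>"
  have "comm_group ?D" by (rule central_subgroup_comm_group[OF CG C(2)])
  moreover have "finite (carrier ?D)" using C.subset finite_carrier by (simp add: finite_subset)
  ultimately show ?thesis
    using n1 decomp an aC by (intro exI[of _ n] conjI exI[of _ ?D]) (auto simp: pow)
qed

end

theorem proposition3:
  fixes G :: "('a, 'm) monoid_scheme"
  shows
    "(\<forall>a\<^sub>0 d r :: int.
        group G \<longrightarrow> finite (carrier G) \<longrightarrow> a\<^sub>0 \<ge> 1 \<longrightarrow> d \<ge> 1 \<longrightarrow> r \<ge> 2 \<longrightarrow>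
        int ` cs G = (\<lambda>i. a\<^sub>0 + i * d) ` {0..r} \<longrightarrow>
          a\<^sub>0 = 1 \<and> d = 1 \<and> r = 2 \<and> cs G = {1, 2, 3} \<and>
          (\<exists>n\<ge>1. \<exists>C :: 'a monoid. comm_group C \<and> finite (carrier C) \<and>
             (\<exists>\<phi> \<in> iso G (Gn n \<times>\<times> C).
                \<phi> ` center G = generate (Gn n) {Gn_a n [^]\<^bsub>Gn n\<^esub> (2::nat)} \<times> carrier C) \<and>
             G Mod center G \<cong> sym_group 3))
     \<and> (\<forall>n\<ge>1. \<forall>C :: ('c, 'k) monoid_scheme. comm_group C \<longrightarrow> finite (carrier C) \<longrightarrow>
          cs (Gn n \<times>\<times> C) = {1, 2, 3})"
proof (intro conjI[of "\<forall>a\<^sub>0 d r. _ a\<^sub>0 d r"] allI impI)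
  fix a\<^sub>0 d r :: int
  assume G: "group G" "finite (carrier G)" and progression: "a\<^sub>0 \<ge> 1" "d \<ge> 1" "r \<ge> 2"
    "int ` cs G = (\<lambda>i. a\<^sub>0 + i * d) ` {0..r}"
  interpret finite_group G by (simp add: finite_group_def finite_group_axioms_def G)
  obtain x k where xk: "a\<^sub>0 = 1" "d = 1" "r = 2" "cs G = {1, 2, 3}"
    "x \<in> carrier G" "card (cls x) = 3" "k \<in> carrier G" "card (cls k) = 2"
    "\<one>\<^bsub>G\<^esub> \<notin> cls k" "rstab (cls x) = insert \<one>\<^bsub>G\<^esub> (cls k)"
    by (rule arithmetic_progression[OF progression])
  have "card (cls g) \<in> {1, 2, 3}" if "g \<in> carrier G" for g
    using that xk(4) unfolding cs_eq by blast
  from class_sizes_123_decomposition[OF this xk(5-10)] xk(1-4)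
  show "a\<^sub>0 = 1 \<and> d = 1 \<and> r = 2 \<and> cs G = {1, 2, 3} \<and>
          (\<exists>n\<ge>1. \<exists>C :: 'a monoid. comm_group C \<and> finite (carrier C) \<and>
             (\<exists>\<phi> \<in> iso G (Gn n \<times>\<times> C).
                \<phi> ` center G = generate (Gn n) {Gn_a n [^]\<^bsub>Gn n\<^esub> (2::nat)} \<times> carrier C) \<and>
             G Mod center G \<cong> sym_group 3)"
    by blast
next
  fix n :: nat and C :: "('c, 'k) monoid_scheme"
  assume "1 \<le> n" "comm_group C"
  then show "cs (Gn n \<times>\<times> C) = {1, 2, 3}" by (rule cs_Gn_times_abelian)
qed

end
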